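(* For every $\eta\in(0,1)$ there is an $N$ such that for all $n\ge N$ the following hold for the adjacent transposition shuffle on permutations of $\{1,\dots,n\}$. (1) For every integer $0\le t\le \left(\frac{1}{\pi^2}-\eta\right)n^3\log n$, the variation distance from stationarity after $t$ shuffles is at least $1-\eta$, and the probability of coalescence by time $t$ is at most $\eta$. (2) For every integer $t\ge \left(\frac{6}{\pi^2}+\eta\right)n^3\log n$, the variation distance from stationarity after $t$ shuffles is at most $\eta$, and the probability of coalescence by time $t$ is at least $1-\eta$. (That is, after $(1/\pi^2-o(1))n^3\log n$ shuffles the variation distance is $1-o(1)$ and the coalescence probability is $o(1)$; after $(6/\pi^2+o(1))n^3\log n$ shuffles the variation distance is $o(1)$ and the coalescence probability is $1-o(1)$.)
   Context: The adjacent transposition shuffle: the state is a permutation of $1,\dots,n$ written as a sequence; at each step choose uniformly one of the $n-1$ pairs of adjacent positions $(i,i+1)$ and flip a fair coin; if heads put the two items in those positions in increasing order, otherwise put them in decreasing order. (Equivalently, as a Markov chain, with probability $1/2$ the random adjacent pair is transposed.) The stationary distribution $U$ is uniform. The variation distance from stationarity after $t$ shuffles is $\|P_x^t-U\|_{TV}=\frac12\|P^t_x-U\|_1$, which does not depend on the starting permutation $x$. The sort/reverse-sort grand coupling applies the same pair and the same coin to all permutations at each step; coalescence by time $t$ means that the coupled copies started from the identity permutation $12\cdots n$ and from its reverse $n(n-1)\cdots1$ are equal at time $t$ (equivalently, the coupled copies from all starting permutations are equal). $\log$ is the natural logarithm. *)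

theory Defs
  imports "HOL-Probability.Probability" "HOL-Combinatorics.Multiset_Permutations"
begin

text \<open>
  A permutation of \<open>1,\<dots>,n\<close> is a list in \<open>permutations_of_set {1..n}\<close>. List positions are
  counted from 0, so the adjacent pairs of positions are \<open>(i, i + 1)\<close> with \<open>i < n - 1\<close>.
\<close>

definition sort_pair :: "nat \<times> bool \<Rightarrow> nat list \<Rightarrow> nat list" where
  "sort_pair m xs =
     (let i = fst m; lo = min (xs ! i) (xs ! Suc i); hi = max (xs ! i) (xs ! Suc i)
      in if snd m then xs[i := lo, Suc i := hi] else xs[i := hi, Suc i := lo])"

text \<open>Meaningful for \<open>n \<ge> 2\<close> only: \<open>pmf_of_set {}\<close> is unspecified.\<close>

definition move_pmf :: "nat \<Rightarrow> (nat \<times> bool) pmf" where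
  "move_pmf n = pair_pmf (pmf_of_set {..<n - 1}) (bernoulli_pmf (1 / 2))"

definition shuffle_step :: "nat \<Rightarrow> nat list \<Rightarrow> nat list pmf" where
  "shuffle_step n xs = map_pmf (\<lambda>m. sort_pair m xs) (move_pmf n)"

primrec shuffle_dist :: "nat \<Rightarrow> nat \<Rightarrow> nat list \<Rightarrow> nat list pmf" where
  "shuffle_dist n 0 xs = return_pmf xs"
| "shuffle_dist n (Suc t) xs = bind_pmf (shuffle_step n xs) (shuffle_dist n t)"

definition tv_dist :: "'a pmf \<Rightarrow> 'a pmf \<Rightarrow> real" where
  "tv_dist p q = 1 / 2 * (\<Sum>\<^sub>\<infinity>x. \<bar>pmf p x - pmf q x\<bar>)"

definition uniform_perm :: "nat \<Rightarrow> nat list pmf" where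
  "uniform_perm n = pmf_of_set (permutations_of_set {1..n})"

definition variation_from_stationarity :: "nat \<Rightarrow> nat \<Rightarrow> nat list \<Rightarrow> real" where
  "variation_from_stationarity n t xs = tv_dist (shuffle_dist n t xs) (uniform_perm n)"

text \<open>
  The grand coupling: one sequence of \<open>t\<close> independent moves, drawn from
  \<open>replicate_pmf t (move_pmf n)\<close>, drives the copies from all starting permutations.
\<close>

definition run_moves :: "(nat \<times> bool) list \<Rightarrow> nat list \<Rightarrow> nat list" where
  "run_moves ms xs = fold sort_pair ms xs"

definition coalesced :: "nat \<Rightarrow> (nat \<times> bool) list \<Rightarrow> bool" where
  "coalesced n ms \<longleftrightarrow> run_moves ms [1..<Suc n] = run_moves ms (rev [1..<Suc n])"

definition coalescence_prob :: "nat \<Rightarrow> nat \<Rightarrow> real" where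
  "coalescence_prob n t =
     measure_pmf.prob (replicate_pmf t (move_pmf n)) {ms. coalesced n ms}"

text \<open>Each coupled copy is a realisation of the shuffle.\<close>

lemma shuffle_dist_eq_run_moves:
  "shuffle_dist n t xs = map_pmf (\<lambda>ms. run_moves ms xs) (replicate_pmf t (move_pmf n))"
proof (induction t arbitrary: xs)
  case 0
  then show ?case by (simp add: run_moves_def)
next
  case (Suc t)
  then show ?case
    by (simp add: run_moves_def shuffle_step_def map_bind_pmf bind_map_pmf map_pmf_def
        bind_assoc_pmf bind_return_pmf)
qed

end

theory Submission
  imports Defs "HOL-Real_Asymp.Real_Asymp"
begin

text \<open>
  For a threshold on the values, the height of a permutation at position \<open>j\<close> counts the small
  items among the first \<open>j\<close> positions, centred so that it vanishes at both ends. A move at positions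
  \<open>(i, i + 1)\<close> changes only the height at \<open>i + 1\<close>, whose mean becomes the average of its two
  neighbours; so heights evolve on average by the discrete heat equation, and the sum of the heights
  with weights \<open>cos (\<beta> (j - n/2))\<close> contracts by the factor \<open>1 - (1 - cos \<beta>) / (n - 1)\<close> up to a
  boundary term.

  For the lower bound take \<open>\<beta> = \<pi>/n\<close>, where the boundary term vanishes and the weighted sum is an
  eigenfunction. Starting from order \<open>n\<^sup>2\<close>, its mean decays like \<open>exp (- \<pi>\<^sup>2 t / (2 n\<^sup>3))\<close>, while its
  variance is of order at most \<open>n\<^sup>3\<close> at all times and in equilibrium; Chebyshev's inequality then
  separates the two distributions as long as the mean is much larger than \<open>n powr (3/2)\<close>.

  For the upper bound take \<open>\<beta>\<close> slightly smaller than \<open>\<pi>/n\<close>. The grand coupling preserves the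
  domination order, so the height differences of the two extreme copies stay nonnegative, the boundary
  term has a favourable sign and all weights are bounded away from 0. Summing over all thresholds, the
  weighted difference starts below \<open>n\<^sup>3\<close> and is bounded below by a constant until coalescence, so
  Markov's inequality applies once \<open>n\<^sup>3 exp (- \<pi>\<^sup>2 t / (2 n\<^sup>3))\<close> is small.
\<close>

subsection \<open>Expectations over sequences of moves\<close>

lemma finite_set_replicate_pmf:
  "finite (set_pmf p) \<Longrightarrow> finite (set_pmf (replicate_pmf t p))"
  using finite_lists_length_eq[of "set_pmf p" t]
  by (simp add: set_replicate_pmf lists_eq_set)

text \<open>Conditioning on the first move: \<open>fold\<close> applies the head of the list first,
  so the other \<open>t\<close> moves start from \<open>step m s\<close>. Finite support settles
  integrability.\<close>

lemma expectation_fold_replicate_pmf_Suc: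
  fixes F :: "'s \<Rightarrow> real"
  assumes "finite (set_pmf p)"
  shows "measure_pmf.expectation (replicate_pmf (Suc t) p) (\<lambda>ms. F (fold step ms s)) =
    measure_pmf.expectation p (\<lambda>m. measure_pmf.expectation (replicate_pmf t p)
      (\<lambda>ms. F (fold step ms (step m s))))"
proof -
  have eq: "replicate_pmf (Suc t) p = p \<bind> (\<lambda>m. map_pmf ((#) m) (replicate_pmf t p))"
    by (simp add: map_pmf_def)
  show ?thesis
    unfolding eq using assms finite_set_replicate_pmf[OF assms]
    by (subst pmf_expectation_bind[of "set_pmf p"])
      (auto simp: integral_measure_pmf[of "set_pmf p" p])
qed

lemma expectation_mono_finite:
  fixes F G :: "'a \<Rightarrow> real"
  assumes "finite (set_pmf p)" "\<And>x. x \<in> set_pmf p \<Longrightarrow> F x \<le> G x"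
  shows "measure_pmf.expectation p F \<le> measure_pmf.expectation p G"
  using assms
  by (simp add: integral_measure_pmf[of "set_pmf p" p] sum_mono mult_left_mono)

text \<open>Iterates an affine one-step drift inequality; the additive errors accumulate to a
  geometric sum. The invariant \<open>I\<close> restricts the drift hypothesis to reachable states.
  The lemma serves for means (\<open>R = 0\<close>) and for second moments
  (\<open>R = 1\<close>).\<close>

lemma expectation_fold_le:
  fixes F :: "'s \<Rightarrow> real"
  assumes fin: "finite (set_pmf p)" and "0 \<le> l" and "I s"
    and inv: "\<And>s m. I s \<Longrightarrow> m \<in> set_pmf p \<Longrightarrow> I (step m s)"
    and drift: "\<And>s. I s \<Longrightarrow> measure_pmf.expectation p (\<lambda>m. F (step m s)) \<le> l * F s + R"
  shows "measure_pmf.expectation (replicate_pmf t p) (\<lambda>ms. F (fold step ms s))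
    \<le> l ^ t * F s + R * (\<Sum>i<t. l ^ i)"
  using \<open>I s\<close>
proof (induction t arbitrary: s)
  case 0
  then show ?case by simp
next
  case (Suc t)
  note int = integrable_measure_pmf_finite[OF fin]
  have "measure_pmf.expectation (replicate_pmf (Suc t) p) (\<lambda>ms. F (fold step ms s)) =
    measure_pmf.expectation p (\<lambda>m. measure_pmf.expectation (replicate_pmf t p)
      (\<lambda>ms. F (fold step ms (step m s))))"
    by (rule expectation_fold_replicate_pmf_Suc[OF fin])
  also have "\<dots> \<le> measure_pmf.expectation p (\<lambda>m. l ^ t * F (step m s) + R * (\<Sum>i<t. l ^ i))"
    using Suc by (intro expectation_mono_finite fin Suc.IH inv) auto
  also have "\<dots> = l ^ t * measure_pmf.expectation p (\<lambda>m. F (step m s)) + R * (\<Sum>i<t. l ^ i)"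
    by (simp add: int)
  also have "\<dots> \<le> l ^ t * (l * F s + R) + R * (\<Sum>i<t. l ^ i)"
    using drift[OF Suc.prems] \<open>0 \<le> l\<close> by (simp add: mult_left_mono)
  finally show ?case
    by (simp add: algebra_simps)
qed

section \<open>Support and mean of a single move\<close>

lemma finite_set_move_pmf: "2 \<le> n \<Longrightarrow> finite (set_pmf (move_pmf n))"
  by (auto simp: move_pmf_def lessThan_empty_iff)

lemma set_move_pmf: "2 \<le> n \<Longrightarrow> set_pmf (move_pmf n) = {..<n - 1} \<times> UNIV"
  by (subst move_pmf_def, subst set_pair_pmf)
    (auto simp: lessThan_empty_iff set_pmf_of_set set_pmf_bernoulli)

lemma expectation_move_pmf:
  fixes F :: "nat \<times> bool \<Rightarrow> real"
  assumes "2 \<le> n"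
  shows "measure_pmf.expectation (move_pmf n) F =
    (\<Sum>i<n - 1. (F (i, True) + F (i, False)) / 2) / real (n - 1)"
proof -
  have ne: "{..<n - 1} \<noteq> {}" using assms by (auto simp: lessThan_empty_iff)
  have "measure_pmf.expectation (move_pmf n) F =
    (\<Sum>a\<in>{..<n - 1} \<times> (UNIV :: bool set). pmf (move_pmf n) a *\<^sub>R F a)"
    by (rule integral_measure_pmf) (auto simp: set_move_pmf[OF assms])
  also have "\<dots> = (\<Sum>i<n - 1. \<Sum>b\<in>UNIV. pmf (move_pmf n) (i, b) *\<^sub>R F (i, b))"
    by (simp add: sum.cartesian_product case_prod_unfold)
  also have "\<dots> = (\<Sum>i<n - 1. (F (i, True) + F (i, False)) / 2 / real (n - 1))"
    using ne by (intro sum.cong refl)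
      (simp add: move_pmf_def UNIV_bool pmf_pair add_divide_distrib del: of_nat_diff)
  finally show ?thesis by (simp add: sum_divide_distrib)
qed

subsection \<open>Sorting moves and height functions\<close>

definition swap_adjacent :: "nat \<Rightarrow> 'a list \<Rightarrow> 'a list" where
  "swap_adjacent i xs = xs[i := xs ! Suc i, Suc i := xs ! i]"

text \<open>One coin outcome leaves the list alone and the other swaps the pair; which is which
  depends on the current order. Hence averages over the coin agree with those of the lazy random
  transposition.\<close>

lemma sort_pair_cases:
  "sort_pair (i, True) xs = xs \<and> sort_pair (i, False) xs = swap_adjacent i xs \<or>
   sort_pair (i, True) xs = swap_adjacent i xs \<and> sort_pair (i, False) xs = xs"
  by (cases "xs ! i \<le> xs ! Suc i")
    (auto simp: sort_pair_def swap_adjacent_def Let_def min_def max_def)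

lemma swap_adjacent_permutation:
  assumes "xs \<in> permutations_of_set {1..n}" "i < n - 1"
  shows "swap_adjacent i xs \<in> permutations_of_set {1..n}"
proof -
  have "length xs = n"
    using length_finite_permutations_of_set[OF assms(1)] by simp
  with assms(2) have "mset (swap_adjacent i xs) = mset xs"
    using mset_swap[of "Suc i" xs i] by (simp add: swap_adjacent_def)
  with assms(1) show ?thesis
    by (metis mset_eq_imp_distinct_iff mset_eq_setD permutations_of_setD permutations_of_setI)
qed

lemma sort_pair_permutation:
  assumes "xs \<in> permutations_of_set {1..n}" "m \<in> set_pmf (move_pmf n)" "2 \<le> n"
  shows "sort_pair m xs \<in> permutations_of_set {1..n}"
proof -
  obtain i b where m: "m = (i, b)" "i < n - 1"
    using assms by (auto simp: set_move_pmf)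
  show ?thesis
    using sort_pair_cases[of i xs] assms(1) swap_adjacent_permutation[OF assms(1) m(2)] m(1)
    by (cases b) auto
qed

lemma run_moves_permutation:
  assumes "xs \<in> permutations_of_set {1..n}" "ms \<in> set_pmf (replicate_pmf t (move_pmf n))" "2 \<le> n"
  shows "run_moves ms xs \<in> permutations_of_set {1..n}"
proof -
  have "set ms \<subseteq> set_pmf (move_pmf n)"
    using assms(2) by (auto simp: set_replicate_pmf)
  then show ?thesis
    unfolding run_moves_def using assms(1)
  proof (induction ms arbitrary: xs)
    case (Cons m ms)
    then show ?case using sort_pair_permutation[of xs n m] assms(3) by simp
  qed simp
qed

text \<open>A general \<open>f\<close> serves both bounds: the indicator of a set of items for the
  lower one, and \<open>- real v\<close> for the upper one, which on items \<open>1..n\<close> is,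
  up to an additive constant, the sum of all threshold indicators. The centring cancels
  constants.\<close>

definition height :: "(nat \<Rightarrow> real) \<Rightarrow> nat \<Rightarrow> nat list \<Rightarrow> nat \<Rightarrow> real" where
  "height f n xs j = (\<Sum>i<j. f (xs ! i)) - real j / real n * (\<Sum>v=1..n. f v)"

lemma height_0 [simp]: "height f n xs 0 = 0"
  by (simp add: height_def)

lemma sum_permutation:
  fixes f :: "nat \<Rightarrow> real"
  assumes "xs \<in> permutations_of_set {1..n}"
  shows "(\<Sum>i<n. f (xs ! i)) = (\<Sum>v=1..n. f v)"
proof -
  have "length xs = n" "distinct xs" "set xs = {1..n}"
    using length_finite_permutations_of_set[OF assms] permutations_of_setD[OF assms] by auto
  then show ?thesis
    using sum.reindex_bij_betw[OF bij_betw_nth[of xs "{..<n}" "{1..n}"], of f] by simp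
qed

lemma height_length:
  assumes "xs \<in> permutations_of_set {1..n}" "0 < n"
  shows "height f n xs n = 0"
  using sum_permutation[OF assms(1)] assms(2) by (simp add: height_def)

text \<open>A prefix whose length is not \<open>Suc i\<close> contains both swapped entries or
  neither of them.\<close>

lemma sum_swap_adjacent:
  fixes f :: "'a \<Rightarrow> 'b :: comm_monoid_add"
  assumes "Suc i < length xs" "j \<noteq> Suc i" "j \<le> length xs"
  shows "(\<Sum>k<j. f (swap_adjacent i xs ! k)) = (\<Sum>k<j. f (xs ! k))"
proof (cases "j \<le> i")
  case True
  then show ?thesis by (intro sum.cong refl) (auto simp: swap_adjacent_def)
next
  case False
  then have "i + 2 \<le> j" using assms(2) by simp
  then show ?thesis
  proof (induction rule: dec_induct)
    case base
    have "(\<Sum>k<i. f (swap_adjacent i xs ! k)) = (\<Sum>k<i. f (xs ! k))"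
      by (intro sum.cong refl) (auto simp: swap_adjacent_def)
    then show ?case using assms(1) by (simp add: swap_adjacent_def ac_simps)
  next
    case (step k)
    then show ?case by (simp add: swap_adjacent_def)
  qed
qed

lemma height_swap_adjacent:
  assumes "Suc i < length xs" "j \<noteq> Suc i" "j \<le> length xs"
  shows "height f n (swap_adjacent i xs) j = height f n xs j"
  using sum_swap_adjacent[OF assms] by (simp add: height_def)

lemma height_sort_pair:
  assumes "Suc i < length xs" "j \<noteq> Suc i" "j \<le> length xs"
  shows "height f n (sort_pair (i, b) xs) j = height f n xs j"
  using height_swap_adjacent[OF assms] sort_pair_cases[of i xs] by (cases b; metis)

text \<open>This is the discrete heat equation. The two outcomes place each entry of the pair once
  at position \<open>i\<close>, so the two prefix sums add up to those of lengths \<open>i\<close>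
  and \<open>i + 2\<close>; the linear centring respects midpoints.\<close>

lemma height_sort_pair_Suc:
  assumes "Suc i < length xs"
  shows "height f n (sort_pair (i, True) xs) (Suc i) + height f n (sort_pair (i, False) xs) (Suc i)
    = height f n xs i + height f n xs (Suc (Suc i))"
proof -
  have "(\<Sum>k<i. f (swap_adjacent i xs ! k)) = (\<Sum>k<i. f (xs ! k))"
    by (intro sum.cong refl) (auto simp: swap_adjacent_def)
  then have "height f n xs (Suc i) + height f n (swap_adjacent i xs) (Suc i)
    = height f n xs i + height f n xs (Suc (Suc i))"
    using assms by (simp add: height_def swap_adjacent_def algebra_simps add_divide_distrib)
  then show ?thesis
    using sort_pair_cases[of i xs] by (metis add.commute)
qed

section \<open>Cosine-weighted sums of heights and their one-step drift\<close>

definition cos_weight :: "nat \<Rightarrow> real \<Rightarrow> nat \<Rightarrow> real" where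
  "cos_weight n \<beta> j = cos (\<beta> * (real j - real n / 2))"

definition cos_sum :: "(nat \<Rightarrow> real) \<Rightarrow> nat \<Rightarrow> real \<Rightarrow> nat list \<Rightarrow> real" where
  "cos_sum f n \<beta> xs = (\<Sum>i<n - 1. cos_weight n \<beta> (Suc i) * height f n xs (Suc i))"

text \<open>Averaging over two neighbours scales the cosine weight by \<open>cos \<beta>\<close>;
  each step updates only one of \<open>n - 1\<close> interior heights, hence the division.\<close>

definition cos_gap :: "nat \<Rightarrow> real \<Rightarrow> real" where
  "cos_gap n \<beta> = (1 - cos \<beta>) / real (n - 1)"

text \<open>The addition formulas for \<open>a - \<beta>\<close> and \<open>a + \<beta>\<close>: the
  weight is an eigenfunction of the discrete Laplacian.\<close>

lemma cos_weight_recurrence: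
  "cos_weight n \<beta> j + cos_weight n \<beta> (Suc (Suc j)) = 2 * cos \<beta> * cos_weight n \<beta> (Suc j)"
proof -
  define a where "a = \<beta> * (real (Suc j) - real n / 2)"
  have "\<beta> * (real j - real n / 2) = a - \<beta>" "\<beta> * (real (Suc (Suc j)) - real n / 2) = a + \<beta>"
    by (auto simp: a_def algebra_simps)
  then show ?thesis
    unfolding cos_weight_def a_def[symmetric] by (simp add: cos_add cos_diff)
qed

text \<open>Summation by parts: moving the neighbour sum from \<open>g\<close> to \<open>w\<close>
  costs only boundary terms, as the difference telescopes.\<close>

lemma discrete_green:
  fixes w g :: "nat \<Rightarrow> real"
  shows "(\<Sum>i<m. w (Suc i) * (g i + g (Suc (Suc i)))) - (\<Sum>i<m. g (Suc i) * (w i + w (Suc (Suc i))))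
    = w 1 * g 0 - w 0 * g 1 + w m * g (Suc m) - w (Suc m) * g m"
  by (induction m) (auto simp: algebra_simps)

lemma cos_sum_sort_pair:
  assumes "length xs = n" "i < n - 1"
  shows "cos_sum f n \<beta> (sort_pair (i, b) xs) = cos_sum f n \<beta> xs +
    cos_weight n \<beta> (Suc i) * (height f n (sort_pair (i, b) xs) (Suc i) - height f n xs (Suc i))"
proof -
  have "cos_sum f n \<beta> (sort_pair (i, b) xs) - cos_sum f n \<beta> xs =
    (\<Sum>k<n - 1. cos_weight n \<beta> (Suc k) *
      (height f n (sort_pair (i, b) xs) (Suc k) - height f n xs (Suc k)))"
    by (simp add: cos_sum_def sum_subtractf right_diff_distrib)
  also have "\<dots> = (\<Sum>k\<in>{i}. cos_weight n \<beta> (Suc k) *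
      (height f n (sort_pair (i, b) xs) (Suc k) - height f n xs (Suc k)))"
    using assms by (intro sum.mono_neutral_right) (auto simp: height_sort_pair)
  finally show ?thesis by simp
qed

lemma expectation_cos_sum:
  assumes xs: "xs \<in> permutations_of_set {1..n}" and n: "2 \<le> n"
  shows "measure_pmf.expectation (move_pmf n) (\<lambda>m. cos_sum f n \<beta> (sort_pair m xs)) =
    (1 - cos_gap n \<beta>) * cos_sum f n \<beta> xs -
    (cos_weight n \<beta> 0 * height f n xs 1 + cos_weight n \<beta> n * height f n xs (n - 1)) / (2 * real (n - 1))"
proof -
  have len: "length xs = n" using length_finite_permutations_of_set[OF xs] by simp
  define w where "w = cos_weight n \<beta>"
  define g where "g = height f n xs"
  define N where "N = real (n - 1)"
  define S where "S = cos_sum f n \<beta> xs"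
  have S: "S = (\<Sum>i<n - 1. w (Suc i) * g (Suc i))"
    by (simp add: S_def w_def g_def cos_sum_def)
  have g0: "g 0 = 0" "g n = 0" using height_length[OF xs] n by (auto simp: g_def)
  have step: "cos_sum f n \<beta> (sort_pair (i, True) xs) + cos_sum f n \<beta> (sort_pair (i, False) xs) =
      2 * S + w (Suc i) * (g i + g (Suc (Suc i)) - 2 * g (Suc i))" if "i < n - 1" for i
  proof -
    have "height f n (sort_pair (i, True) xs) (Suc i) =
        g i + g (Suc (Suc i)) - height f n (sort_pair (i, False) xs) (Suc i)"
      using height_sort_pair_Suc[of i xs f n] that len unfolding g_def by linarith
    then show ?thesis
      using that len by (simp add: cos_sum_sort_pair flip: w_def g_def S_def) (simp add: algebra_simps)
  qed
  have "(\<Sum>i<n - 1. (cos_sum f n \<beta> (sort_pair (i, True) xs) + cos_sum f n \<beta> (sort_pair (i, False) xs)) / 2)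
    = (\<Sum>i<n - 1. S + (w (Suc i) * (g i + g (Suc (Suc i)))) / 2 - w (Suc i) * g (Suc i))"
    by (intro sum.cong refl) (subst step, auto simp: field_simps)
  also have "\<dots> = real (n - 1) * S + (\<Sum>i<n - 1. w (Suc i) * (g i + g (Suc (Suc i)))) / 2 - S"
    by (simp add: sum.distrib sum_subtractf S sum_divide_distrib)
  \<comment> \<open>The height vanishes at both ends, so summation by parts leaves only the boundary
    terms carrying the weights at \<open>0\<close> and \<open>n\<close>.\<close>
  also have "(\<Sum>i<n - 1. w (Suc i) * (g i + g (Suc (Suc i)))) =
     (\<Sum>i<n - 1. g (Suc i) * (w i + w (Suc (Suc i)))) - (w 0 * g 1 + w n * g (n - 1))"
    using discrete_green[of w g "n - 1"] n g0 by simp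
  also have "(\<Sum>i<n - 1. g (Suc i) * (w i + w (Suc (Suc i)))) = 2 * cos \<beta> * S"
    unfolding S w_def cos_weight_recurrence by (simp add: sum_distrib_left algebra_simps)
  finally have eq: "(\<Sum>i<n - 1. (cos_sum f n \<beta> (sort_pair (i, True) xs) + cos_sum f n \<beta> (sort_pair (i, False) xs)) / 2)
    = N * S + (2 * cos \<beta> * S - (w 0 * g 1 + w n * g (n - 1))) / 2 - S"
    unfolding N_def .
  have "N \<noteq> 0" using n by (simp add: N_def)
  then show ?thesis
    unfolding expectation_move_pmf[OF n] eq cos_gap_def w_def[symmetric] g_def[symmetric]
      S_def[symmetric] N_def[symmetric]
    by (simp add: field_simps)
qed

subsection \<open>Total variation distance\<close>

lemma tv_dist_finite:
  assumes "finite S" "set_pmf p \<subseteq> S" "set_pmf q \<subseteq> S"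
  shows "tv_dist p q = (\<Sum>x\<in>S. \<bar>pmf p x - pmf q x\<bar>) / 2"
proof -
  have "pmf p x = 0" "pmf q x = 0" if "x \<notin> S" for x
    using assms that by (auto simp: pmf_eq_0_set_pmf)
  then have "(\<Sum>\<^sub>\<infinity>x. \<bar>pmf p x - pmf q x\<bar>) = (\<Sum>\<^sub>\<infinity>x\<in>S. \<bar>pmf p x - pmf q x\<bar>)"
    by (intro infsum_cong_neutral) auto
  then show ?thesis
    using assms(1) by (simp add: tv_dist_def)
qed

text \<open>Both total masses are 1, so the excess of \<open>p\<close> on \<open>B\<close> equals
  its deficit off \<open>B\<close>. Averaging the two gives a symmetric form that compares directly
  with the \<open>L1\<close> distance.\<close>

lemma prob_diff_finite:
  assumes "finite S" "set_pmf p \<subseteq> S" "set_pmf q \<subseteq> S"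
  shows "measure_pmf.prob p B - measure_pmf.prob q B =
    ((\<Sum>x\<in>S \<inter> B. pmf p x - pmf q x) - (\<Sum>x\<in>S - B. pmf p x - pmf q x)) / 2"
proof -
  have *: "measure_pmf.prob r B = (\<Sum>x\<in>S \<inter> B. pmf r x)"
      "(\<Sum>x\<in>S \<inter> B. pmf r x) + (\<Sum>x\<in>S - B. pmf r x) = 1" if "set_pmf r \<subseteq> S" for r
  proof -
    have "measure_pmf.prob r B = measure_pmf.prob r (S \<inter> B)"
      using that by (intro measure_prob_cong_0) (auto simp: pmf_eq_0_set_pmf)
    then show "measure_pmf.prob r B = (\<Sum>x\<in>S \<inter> B. pmf r x)"
      using assms(1) by (simp add: measure_measure_pmf_finite)
    have "(\<Sum>x\<in>S. pmf r x) = 1"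
      using that assms(1) by (intro sum_pmf_eq_1)
    then show "(\<Sum>x\<in>S \<inter> B. pmf r x) + (\<Sum>x\<in>S - B. pmf r x) = 1"
      using sum.Int_Diff[OF assms(1), of "pmf r" B] by simp
  qed
  show ?thesis
    using *[OF assms(2)] *[OF assms(3)] by (simp add: sum_subtractf)
qed

lemma prob_diff_le_tv_dist:
  assumes "finite S" "set_pmf p \<subseteq> S" "set_pmf q \<subseteq> S"
  shows "measure_pmf.prob p B - measure_pmf.prob q B \<le> tv_dist p q"
proof -
  have "(\<Sum>x\<in>S \<inter> B. pmf p x - pmf q x) - (\<Sum>x\<in>S - B. pmf p x - pmf q x)
    \<le> (\<Sum>x\<in>S \<inter> B. \<bar>pmf p x - pmf q x\<bar>) + (\<Sum>x\<in>S - B. \<bar>pmf p x - pmf q x\<bar>)"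
    by (simp only: diff_conv_add_uminus sum_negf[symmetric], intro add_mono sum_mono) auto
  also have "\<dots> = (\<Sum>x\<in>S. \<bar>pmf p x - pmf q x\<bar>)"
    by (rule sum.Int_Diff[OF assms(1), symmetric])
  finally show ?thesis
    unfolding prob_diff_finite[OF assms] tv_dist_finite[OF assms] by simp
qed

lemma tv_dist_attained:
  assumes "finite S" "set_pmf p \<subseteq> S" "set_pmf q \<subseteq> S"
  shows "\<exists>B. tv_dist p q = measure_pmf.prob p B - measure_pmf.prob q B"
proof
  \<comment> \<open>Where \<open>p\<close> is at least \<open>q\<close>: every signed term of
    \<open>prob_diff_finite\<close> becomes an absolute value.\<close>
  define B where "B = {x. pmf q x \<le> pmf p x}"
  have "(\<Sum>x\<in>S. \<bar>pmf p x - pmf q x\<bar>) =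
      (\<Sum>x\<in>S \<inter> B. \<bar>pmf p x - pmf q x\<bar>) + (\<Sum>x\<in>S - B. \<bar>pmf p x - pmf q x\<bar>)"
    by (rule sum.Int_Diff[OF assms(1)])
  also have "\<dots> = (\<Sum>x\<in>S \<inter> B. pmf p x - pmf q x) + (\<Sum>x\<in>S - B. - (pmf p x - pmf q x))"
    by (intro arg_cong2[of _ _ _ _ "(+)"] sum.cong) (auto simp: B_def)
  finally show "tv_dist p q = measure_pmf.prob p B - measure_pmf.prob q B"
    unfolding prob_diff_finite[OF assms] tv_dist_finite[OF assms] sum_negf by simp
qed

subsection \<open>Stationarity of the uniform distribution\<close>

lemma swap_adjacent_involution:
  "Suc i < length xs \<Longrightarrow> swap_adjacent i (swap_adjacent i xs) = xs"
  by (auto simp: swap_adjacent_def list_eq_iff_nth_eq nth_list_update)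

text \<open>Stationarity of the uniform law in summed form: for a fixed pair the two coin outcomes
  are \<open>x\<close> and its swap, and swapping is an involution on the permutations.\<close>

lemma sum_permutations_step:
  fixes G :: "nat list \<Rightarrow> real"
  assumes "2 \<le> n"
  shows "(\<Sum>x\<in>permutations_of_set {1..n}. measure_pmf.expectation (move_pmf n) (\<lambda>m. G (sort_pair m x)))
    = (\<Sum>x\<in>permutations_of_set {1..n}. G x)"
proof -
  let ?P = "permutations_of_set {1..n}"
  have "(\<Sum>x\<in>?P. G (sort_pair (i, True) x) + G (sort_pair (i, False) x)) = 2 * (\<Sum>x\<in>?P. G x)"
    if "i < n - 1" for i
  proof -
    have swap: "swap_adjacent i x \<in> ?P" "swap_adjacent i (swap_adjacent i x) = x" if "x \<in> ?P" for x
      using swap_adjacent_permutation[OF that \<open>i < n - 1\<close>] \<open>i < n - 1\<close>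
        length_finite_permutations_of_set[OF that] by (auto intro: swap_adjacent_involution)
    have "(\<Sum>x\<in>?P. G (swap_adjacent i x)) = (\<Sum>x\<in>?P. G x)"
      by (rule sum.reindex_bij_witness[of _ "swap_adjacent i" "swap_adjacent i"]) (use swap in auto)
    moreover have "G (sort_pair (i, True) x) + G (sort_pair (i, False) x) = G x + G (swap_adjacent i x)" for x
      using sort_pair_cases[of i x] by auto
    ultimately show ?thesis by (simp add: sum.distrib)
  qed
  then have "(\<Sum>i<n - 1. \<Sum>x\<in>?P. (G (sort_pair (i, True) x) + G (sort_pair (i, False) x)) / 2)
    = real (n - 1) * (\<Sum>x\<in>?P. G x)"
    by (simp flip: sum_divide_distrib)
  then have "(\<Sum>x\<in>?P. \<Sum>i<n - 1. (G (sort_pair (i, True) x) + G (sort_pair (i, False) x)) / 2)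
    = real (n - 1) * (\<Sum>x\<in>?P. G x)"
    by (subst sum.swap)
  moreover have "real (n - 1) \<noteq> 0"
    using assms by simp
  ultimately show ?thesis
    unfolding expectation_move_pmf[OF assms] sum_divide_distrib[symmetric] by simp
qed

lemma sum_permutations_run_moves:
  fixes G :: "nat list \<Rightarrow> real"
  assumes "2 \<le> n"
  shows "(\<Sum>x\<in>permutations_of_set {1..n}.
      measure_pmf.expectation (replicate_pmf t (move_pmf n)) (\<lambda>ms. G (run_moves ms x)))
    = (\<Sum>x\<in>permutations_of_set {1..n}. G x)"
proof (induction t)
  case 0
  then show ?case by (simp add: run_moves_def)
next
  case (Suc t)
  then show ?case
    \<comment> \<open>The one-step identity is applied to the expected value after the remaining
      \<open>t\<close> moves, as a function of the state.\<close>
    unfolding run_moves_def expectation_fold_replicate_pmf_Suc[OF finite_set_move_pmf[OF assms]]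
    by (subst sum_permutations_step[OF assms])
qed

lemma prob_shuffle_dist:
  "measure_pmf.prob (shuffle_dist n t x) B =
    measure_pmf.expectation (replicate_pmf t (move_pmf n)) (\<lambda>ms. indicator B (run_moves ms x))"
proof -
  have "measure_pmf.prob (shuffle_dist n t x) B = measure_pmf.expectation (shuffle_dist n t x) (indicator B)"
    by simp
  then show ?thesis
    unfolding shuffle_dist_eq_run_moves integral_map_pmf .
qed

lemma prob_uniform_perm:
  "measure_pmf.prob (uniform_perm n) B =
    (\<Sum>x\<in>permutations_of_set {1..n}. indicator B x) / card (permutations_of_set {1..n})"
proof -
  have "measure_pmf.prob (uniform_perm n) B = measure_pmf.expectation (uniform_perm n) (indicator B)"
    by simp
  then show ?thesis
    unfolding uniform_perm_def by (subst (asm) integral_pmf_of_set) auto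
qed

lemma variation_support:
  assumes "x \<in> permutations_of_set {1..n}" "2 \<le> n"
  shows "set_pmf (shuffle_dist n t x) \<subseteq> permutations_of_set {1..n}"
    "set_pmf (uniform_perm n) \<subseteq> permutations_of_set {1..n}"
  using assms run_moves_permutation
  by (auto simp: shuffle_dist_eq_run_moves uniform_perm_def)

subsection \<open>Monotonicity of the grand coupling\<close>

definition count_le :: "nat \<Rightarrow> nat list \<Rightarrow> nat \<Rightarrow> nat" where
  "count_le k xs j = (\<Sum>i<j. of_bool (xs ! i \<le> k))"

text \<open>On permutations of \<open>1..n\<close> this is the strong Bruhat order: the dominating
  list has its small items further to the left.\<close>

definition dominates :: "nat \<Rightarrow> nat list \<Rightarrow> nat list \<Rightarrow> bool" where
  "dominates n x y \<longleftrightarrow> (\<forall>k. \<forall>j\<le>n. count_le k y j \<le> count_le k x j)"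

text \<open>Sorting raises the middle count as early as the counts on either side permit, reverse
  sorting as late as possible. Both formulas are monotone in the outer counts, which is why
  domination survives a common move.\<close>

lemma count_le_sort_pair:
  assumes "Suc i < length xs" "j \<le> length xs"
  shows "count_le k (sort_pair (i, b) xs) j =
    (if j = Suc i then
       if b then min (count_le k xs i + 1) (count_le k xs (i + 2))
       else max (count_le k xs i) (count_le k xs (i + 2) - 1)
     else count_le k xs j)"
proof (cases "j = Suc i")
  case True
  have "count_le k (sort_pair (i, b) xs) i = count_le k xs i"
    unfolding count_le_def by (intro sum.cong refl) (auto simp: sort_pair_def Let_def)
  then have "count_le k (sort_pair (i, b) xs) (Suc i) =
      count_le k xs i + of_bool ((if b then min (xs ! i) (xs ! Suc i) else max (xs ! i) (xs ! Suc i)) \<le> k)"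
    using assms(1) by (simp add: count_le_def sort_pair_def Let_def)
  moreover have "count_le k xs (i + 2) =
      count_le k xs i + of_bool (xs ! i \<le> k) + of_bool (xs ! Suc i \<le> k)"
    by (simp add: count_le_def)
  ultimately show ?thesis
    using True by (auto simp: min_def max_def split: if_splits)
next
  case False
  show ?thesis
    using sum_swap_adjacent[OF assms(1) False assms(2), of "\<lambda>v. of_bool (v \<le> k) :: nat"]
      sort_pair_cases[of i xs] False
    by (cases b) (auto simp: count_le_def)
qed

lemma dominates_sort_pair:
  assumes "dominates n x y" "length x = n" "length y = n" "i < n - 1"
  shows "dominates n (sort_pair (i, b) x) (sort_pair (i, b) y)"
  unfolding dominates_def
proof (intro allI impI)
  fix k j assume "j \<le> n"
  have "count_le k y l \<le> count_le k x l" if "l \<le> n" for l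
    using assms(1) that by (simp add: dominates_def)
  from this[OF \<open>j \<le> n\<close>] this[of i] this[of "i + 2"]
  have "count_le k y j \<le> count_le k x j" "count_le k y i \<le> count_le k x i"
      "count_le k y (i + 2) \<le> count_le k x (i + 2)"
    using assms(4) by auto
  then show "count_le k (sort_pair (i, b) y) j \<le> count_le k (sort_pair (i, b) x) j"
    using assms(2-4) \<open>j \<le> n\<close>
    by (simp only: count_le_sort_pair split: if_split) (auto simp: count_le_sort_pair)
qed

lemma dominates_run_moves:
  assumes "dominates n x y" "length x = n" "length y = n" "2 \<le> n"
    "ms \<in> set_pmf (replicate_pmf t (move_pmf n))"
  shows "dominates n (run_moves ms x) (run_moves ms y)"
proof -
  have "set ms \<subseteq> {..<n - 1} \<times> UNIV"
    using assms(4,5) by (auto simp: set_replicate_pmf set_move_pmf)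
  then show ?thesis
    unfolding run_moves_def using assms(1-3)
  proof (induction ms arbitrary: x y)
    case (Cons m ms)
    obtain i b where "m = (i, b)" "i < n - 1" using Cons.prems(1) by auto
    moreover have "length (sort_pair m z) = length z" for z
      by (simp add: sort_pair_def Let_def)
    ultimately show ?case
      using Cons dominates_sort_pair[of n x y i b] by simp
  qed simp
qed

text \<open>Equal counts at \<open>i\<close> and \<open>Suc i\<close> for every threshold determine
  the entry at position \<open>i\<close>.\<close>

lemma dominates_antisym:
  assumes "dominates n x y" "dominates n y x" "length x = n" "length y = n"
  shows "x = y"
proof (rule nth_equalityI)
  fix i assume i: "i < length x"
  have eq: "count_le k x j = count_le k y j" if "j \<le> n" for k j
    using assms(1,2) that by (auto simp: dominates_def intro!: antisym)
  have "of_bool (x ! i \<le> k) = (of_bool (y ! i \<le> k) :: nat)" for k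
    using eq[of "Suc i" k] eq[of i k] i assms(3) by (simp add: count_le_def)
  then have "x ! i \<le> k \<longleftrightarrow> y ! i \<le> k" for k
    by (metis of_bool_eq_iff)
  then show "x ! i = y ! i" by (meson antisym order_refl)
qed (use assms in simp)

section \<open>The identity and its reversal as extremes of the order\<close>

lemma count_le_upt: "j \<le> n \<Longrightarrow> count_le k [1..<Suc n] j = min j k"
  by (induction j) (auto simp: count_le_def simp del: upt_Suc)

lemma count_le_rev_upt: "j \<le> n \<Longrightarrow> count_le k (rev [1..<Suc n]) j = j - (n - k)"
  by (induction j) (auto simp: count_le_def rev_nth simp del: upt_Suc)

text \<open>By distinctness at most \<open>k\<close> entries are \<open>\<le> k\<close> and at most
  \<open>n - k\<close> exceed \<open>k\<close>. These bounds are the counts of the identity and of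
  its reversal; truncated subtraction covers short prefixes and \<open>k > n\<close>.\<close>

lemma count_le_permutation:
  assumes "x \<in> permutations_of_set {1..n}" "j \<le> n"
  shows "count_le k x j \<le> min j k" "j - (n - k) \<le> count_le k x j"
proof -
  have x: "length x = n" "distinct x" "set x = {1..n}"
    using length_finite_permutations_of_set[OF assms(1)] permutations_of_setD[OF assms(1)] by auto
  have inj: "inj_on ((!) x) S" if "S \<subseteq> {..<j}" for S
    using that assms(2) x by (intro inj_on_subset[OF inj_on_nth[of x "{..<n}"]]) auto
  have count: "count_le k x j = card {i. i < j \<and> x ! i \<le> k}"
    by (simp add: count_le_def of_bool_def sum.If_cases) (rule arg_cong[of _ _ card], auto)
  have "card {i. i < j \<and> x ! i \<le> k} \<le> card {1..k}"
    using x assms(2) nth_mem[of _ x]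
    by (intro card_inj_on_le[of "(!) x"] inj) force+
  moreover have "card {i. i < j \<and> x ! i \<le> k} \<le> card {..<j}"
    by (intro card_mono) auto
  ultimately show "count_le k x j \<le> min j k"
    by (simp add: count)
  have "card {i. i < j \<and> k < x ! i} \<le> card {Suc k..n}"
    using x assms(2) nth_mem[of _ x]
    by (intro card_inj_on_le[of "(!) x"] inj) force+
  moreover have "card {..<j} = card {i. i < j \<and> x ! i \<le> k} + card {i. i < j \<and> k < x ! i}"
    by (subst card_Un_disjoint[symmetric]) (auto intro!: arg_cong[of "{..<j}" _ card] simp del: card_lessThan)
  ultimately show "j - (n - k) \<le> count_le k x j"
    by (simp add: count)
qed

lemma upt_permutation:
  "[1..<Suc n] \<in> permutations_of_set {1..n}" "rev [1..<Suc n] \<in> permutations_of_set {1..n}"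
  by (auto intro!: permutations_of_setI simp del: upt_Suc)

lemma dominates_upt:
  assumes "x \<in> permutations_of_set {1..n}"
  shows "dominates n [1..<Suc n] x" "dominates n x (rev [1..<Suc n])"
  using count_le_permutation[OF assms]
  unfolding dominates_def by (auto simp: count_le_upt count_le_rev_upt simp del: upt_Suc One_nat_def)

text \<open>Every copy stays sandwiched between the two extreme copies; once these agree,
  antisymmetry forces equality.\<close>

lemma coalesced_run_moves:
  assumes "coalesced n ms" "x \<in> permutations_of_set {1..n}" "2 \<le> n"
    "ms \<in> set_pmf (replicate_pmf t (move_pmf n))"
  shows "run_moves ms x = run_moves ms [1..<Suc n]"
proof -
  note len = length_finite_permutations_of_set[of _ "{1..n}", simplified]
  have xs: "length x = n" "length (run_moves ms x) = n" "length (run_moves ms [1..<Suc n]) = n"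
    using run_moves_permutation[OF assms(2,4,3)]
      run_moves_permutation[OF upt_permutation(1) assms(4,3)] assms(2)
    by (auto intro!: len simp del: upt_Suc)
  have "dominates n (run_moves ms [1..<Suc n]) (run_moves ms x)"
    by (rule dominates_run_moves[OF dominates_upt(1)[OF assms(2)] _ _ assms(3,4)])
      (use xs in \<open>auto simp del: upt_Suc\<close>)
  moreover have "dominates n (run_moves ms x) (run_moves ms (rev [1..<Suc n]))"
    by (rule dominates_run_moves[OF dominates_upt(2)[OF assms(2)] _ _ assms(3,4)])
      (use xs in \<open>auto simp del: upt_Suc\<close>)
  ultimately show ?thesis
    using assms(1) xs unfolding coalesced_def by (intro dominates_antisym[of n]) (simp_all del: upt_Suc)
qed

text \<open>The coupling inequality: compare the copy from \<open>x\<close> with the copy from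
  \<open>y\<close>, then average over all \<open>y\<close>.\<close>

lemma variation_le_not_coalesced:
  assumes x: "x \<in> permutations_of_set {1..n}" and n: "2 \<le> n"
  shows "variation_from_stationarity n t x \<le> 1 - coalescence_prob n t"
proof -
  let ?P = "permutations_of_set {1..n}"
  define Q where "Q = replicate_pmf t (move_pmf n)"
  have fin: "finite (set_pmf Q)"
    unfolding Q_def by (intro finite_set_replicate_pmf finite_set_move_pmf n)
  note int = integrable_measure_pmf_finite[OF fin]
  obtain B where B: "variation_from_stationarity n t x =
      measure_pmf.prob (shuffle_dist n t x) B - measure_pmf.prob (uniform_perm n) B"
    using tv_dist_attained[OF finite_permutations_of_set variation_support[OF x n]]
    unfolding variation_from_stationarity_def by blast
  define u where "u y = measure_pmf.expectation Q (\<lambda>ms. indicator B (run_moves ms y) :: real)" for y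
  have card: "card ?P > 0"
    by (simp add: card_gt_0_iff)
  have "u x - u y \<le> 1 - coalescence_prob n t" if "y \<in> ?P" for y
  proof -
    have "u x - u y = measure_pmf.expectation Q (\<lambda>ms. indicator B (run_moves ms x) - indicator B (run_moves ms y) :: real)"
      by (simp add: u_def int)
    \<comment> \<open>After coalescence the two indicators agree; before it they differ by at most
      1.\<close>
    also have "\<dots> \<le> measure_pmf.expectation Q (\<lambda>ms. 1 - indicator {ms. coalesced n ms} ms)"
      using coalesced_run_moves[OF _ x n] coalesced_run_moves[OF _ that n]
      by (intro expectation_mono_finite fin) (auto simp: indicator_def Q_def)
    also have "\<dots> = 1 - coalescence_prob n t"
      by (simp add: int coalescence_prob_def Q_def[symmetric])
    finally show ?thesis .
  qed
  then have "(\<Sum>y\<in>?P. u x - u y) \<le> (\<Sum>y\<in>?P. 1 - coalescence_prob n t)"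
    by (intro sum_mono)
  then have "real (card ?P) * u x - (\<Sum>y\<in>?P. u y) \<le> real (card ?P) * (1 - coalescence_prob n t)"
    by (simp add: sum_subtractf)
  \<comment> \<open>Stationarity turns the average of \<open>u\<close> into the uniform probability
    of \<open>B\<close>.\<close>
  moreover have "(\<Sum>y\<in>?P. u y) = (\<Sum>y\<in>?P. indicator B y)"
    unfolding u_def Q_def by (rule sum_permutations_run_moves[OF n])
  ultimately have "u x - (\<Sum>y\<in>?P. indicator B y) / real (card ?P) \<le> 1 - coalescence_prob n t"
    using card by (simp add: field_simps)
  then show ?thesis
    unfolding B prob_uniform_perm prob_shuffle_dist u_def Q_def by simp
qed

subsection \<open>Bounds for the coupling and for the variation distance\<close>

lemma cos_gap_le_1:
  assumes "2 \<le> n" "0 \<le> \<beta>" "\<beta> * real n \<le> pi"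
  shows "cos_gap n \<beta> \<le> 1"
proof -
  have "\<beta> * 2 \<le> \<beta> * real n"
    using assms by (intro mult_left_mono) auto
  then have "0 \<le> cos \<beta>"
    using assms by (intro cos_ge_zero) auto
  then show ?thesis
    using assms by (simp add: cos_gap_def divide_simps of_nat_diff)
qed

text \<open>The cosine decreases with the distance of \<open>j\<close> from the centre, so the
  endpoints are the worst case.\<close>

lemma cos_weight_ge:
  assumes "0 \<le> \<beta>" "\<beta> * real n \<le> pi" "j \<le> n"
  shows "cos (\<beta> * real n / 2) \<le> cos_weight n \<beta> j"
proof -
  have "\<bar>real j - real n / 2\<bar> \<le> real n / 2"
    using assms(3) unfolding abs_le_iff by (intro conjI; linarith)
  then have "\<bar>\<beta> * (real j - real n / 2)\<bar> \<le> \<beta> * (real n / 2)"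
    unfolding abs_mult using assms by (intro mult_mono) auto
  moreover have "cos (\<beta> * (real n / 2)) \<le> cos \<bar>\<beta> * (real j - real n / 2)\<bar>"
    using assms calculation pi_ge_zero by (intro cos_monotone_0_pi_le) (auto simp del: pi_ge_zero)
  ultimately show ?thesis
    by (simp add: cos_weight_def)
qed

lemma cos_weight_nonneg:
  assumes "0 \<le> \<beta>" "\<beta> * real n \<le> pi" "j \<le> n"
  shows "0 \<le> cos_weight n \<beta> j"
proof -
  have "0 \<le> \<beta> * real n / 2"
    using assms(1) by simp
  then have "0 \<le> cos (\<beta> * real n / 2)"
    using assms(2) pi_ge_zero by (intro cos_ge_zero) linarith+
  with cos_weight_ge[OF assms] show ?thesis by simp
qed

text \<open>The centring terms cancel. The minus sign gives the larger height to the dominating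
  copy, whose prefix sums are smaller.\<close>

lemma height_neg_diff:
  "height (\<lambda>v. - real v) n x j - height (\<lambda>v. - real v) n y j = (\<Sum>i<j. real (y ! i)) - (\<Sum>i<j. real (x ! i))"
  by (simp add: height_def sum_negf)

text \<open>Layer-cake summation over thresholds: an item \<open>v\<close> lies below exactly
  \<open>n - v\<close> thresholds \<open>k < n\<close>.\<close>

lemma sum_count_le:
  assumes "x \<in> permutations_of_set {1..n}" "j \<le> n"
  shows "(\<Sum>k<n. count_le k x j) + (\<Sum>i<j. x ! i) = j * n"
proof -
  have x: "length x = n" "set x = {1..n}"
    using length_finite_permutations_of_set[OF assms(1)] permutations_of_setD[OF assms(1)] by auto
  have "(\<Sum>k<n. of_bool (x ! i \<le> k)) + x ! i = n" if "i < j" for i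
  proof -
    have "x ! i \<le> n"
      using nth_mem[of i x] x that assms(2) by auto
    moreover have "{..<n} \<inter> {k. x ! i \<le> k} = {x ! i..<n}" by auto
    ultimately show ?thesis by (simp add: of_bool_def sum.If_cases)
  qed
  then have "(\<Sum>i<j. (\<Sum>k<n. of_bool (x ! i \<le> k)) + x ! i) = j * n"
    by simp
  then show ?thesis
    unfolding count_le_def by (subst sum.swap) (simp add: sum.distrib)
qed

lemma dominates_sum_le:
  assumes "dominates n x y" "x \<in> permutations_of_set {1..n}" "y \<in> permutations_of_set {1..n}" "j \<le> n"
  shows "(\<Sum>i<j. x ! i) \<le> (\<Sum>i<j. y ! i)"
proof -
  have "(\<Sum>k<n. count_le k y j) \<le> (\<Sum>k<n. count_le k x j)"
    using assms(1,4) by (intro sum_mono) (auto simp: dominates_def)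
  with sum_count_le[OF assms(2,4)] sum_count_le[OF assms(3,4)] show ?thesis by linarith
qed

text \<open>The prefix sums of lengths \<open>0\<close> and \<open>n\<close> always agree; if the
  interior ones did too, consecutive differences would identify the lists.\<close>

lemma distinct_permutations_prefix_sum:
  fixes x y :: "nat list"
  assumes "x \<in> permutations_of_set {1..n}" "y \<in> permutations_of_set {1..n}" "x \<noteq> y"
  shows "\<exists>j<n - 1. (\<Sum>i<Suc j. x ! i) \<noteq> (\<Sum>i<Suc j. y ! i)"
proof (rule ccontr)
  assume eq: "\<not> ?thesis"
  have len: "length x = n" "length y = n"
    using assms(1,2) by (auto dest: length_finite_permutations_of_set)
  have sums: "(\<Sum>i<j. x ! i) = (\<Sum>i<j. y ! i)" if j: "j \<le> n" for j
  proof -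
    consider "j = 0" | "j = n" | "0 < j" "j < n" using j by linarith
    then show ?thesis
    proof cases
      case 2
      have "real (\<Sum>i<n. x ! i) = real (\<Sum>i<n. y ! i)"
        using sum_permutation[OF assms(1), of real] sum_permutation[OF assms(2), of real] by simp
      with 2 show ?thesis by (simp only: of_nat_eq_iff)
    next
      case 3
      then obtain l where "j = Suc l" "l < n - 1" by (cases j) auto
      with eq show ?thesis by blast
    qed simp
  qed
  have "x ! i = y ! i" if "i < n" for i
    using sums[of i] sums[of "Suc i"] that by simp
  with assms(3) len show False
    by (metis nth_equalityI)
qed

text \<open>Markov's inequality for the weighted height difference \<open>F\<close> of the extreme
  copies: at most \<open>real n ^ 3\<close> initially, contracting on average, and at least the
  smallest weight until coalescence.\<close>

lemma not_coalesced_le: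
  assumes n: "2 \<le> n" and \<beta>: "0 \<le> \<beta>" "\<beta> * real n \<le> pi" and pos: "0 < cos (\<beta> * real n / 2)"
  shows "1 - coalescence_prob n t \<le> real n ^ 3 * (1 - cos_gap n \<beta>) ^ t / cos (\<beta> * real n / 2)"
proof -
  define c where "c = cos (\<beta> * real n / 2)"
  define Q where "Q = replicate_pmf t (move_pmf n)"
  define f :: "nat \<Rightarrow> real" where "f v = - real v" for v
  define F where "F s = cos_sum f n \<beta> (fst s) - cos_sum f n \<beta> (snd s)" for s
  define step where "step m s = (sort_pair m (fst s), sort_pair m (snd s))" for m s
  \<comment> \<open>Domination belongs to the invariant because the drift bound depends on the sign
    of the height differences.\<close>
  define I where "I s \<longleftrightarrow> fst s \<in> permutations_of_set {1..n} \<and> snd s \<in> permutations_of_set {1..n} \<and>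
    dominates n (fst s) (snd s)" for s
  have fin: "finite (set_pmf (move_pmf n))" and finQ: "finite (set_pmf Q)"
    unfolding Q_def by (intro finite_set_replicate_pmf finite_set_move_pmf n)+
  note int = integrable_measure_pmf_finite[OF fin] and intQ = integrable_measure_pmf_finite[OF finQ]
  note w = cos_weight_nonneg[OF \<beta>]
  have diff: "0 \<le> height f n (fst s) j - height f n (snd s) j" if "I s" "j \<le> n" for s j
  proof -
    have "(\<Sum>i<j. fst s ! i) \<le> (\<Sum>i<j. snd s ! i)"
      using that by (intro dominates_sum_le[of n]) (auto simp: I_def)
    then have "real (\<Sum>i<j. fst s ! i) \<le> real (\<Sum>i<j. snd s ! i)"
      by (simp only: of_nat_le_iff)
    then show ?thesis
      using height_neg_diff[of n "fst s" j "snd s"] by (simp add: f_def[abs_def])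
  qed
  have F: "F s = (\<Sum>i<n - 1. cos_weight n \<beta> (Suc i) * (height f n (fst s) (Suc i) - height f n (snd s) (Suc i)))" for s
    by (simp add: F_def cos_sum_def sum_subtractf right_diff_distrib)
  have F_nonneg: "0 \<le> F s" if "I s" for s
    unfolding F using that by (intro sum_nonneg mult_nonneg_nonneg w diff) auto
  \<comment> \<open>Distinct copies differ in some prefix sum; domination and integrality make that
    height difference at least 1, with weight at least \<open>c\<close>.\<close>
  have F_ge: "c \<le> F s" if s: "I s" "fst s \<noteq> snd s" for s
  proof -
    obtain j where j: "j < n - 1" "(\<Sum>i<Suc j. fst s ! i) \<noteq> (\<Sum>i<Suc j. snd s ! i)"
      using distinct_permutations_prefix_sum[of "fst s" n "snd s"] s unfolding I_def by blast
    have "(\<Sum>i<Suc j. fst s ! i) \<le> (\<Sum>i<Suc j. snd s ! i)"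
      using that(1) j(1) by (intro dominates_sum_le[of n]) (auto simp: I_def)
    with j(2) have "(\<Sum>i<Suc j. fst s ! i) + 1 \<le> (\<Sum>i<Suc j. snd s ! i)"
      by linarith
    then have "real ((\<Sum>i<Suc j. fst s ! i) + 1) \<le> real (\<Sum>i<Suc j. snd s ! i)"
      by (simp only: of_nat_le_iff)
    then have "1 \<le> height f n (fst s) (Suc j) - height f n (snd s) (Suc j)"
      using height_neg_diff[of n "fst s" "Suc j" "snd s"] by (simp add: f_def[abs_def])
    moreover have "c \<le> cos_weight n \<beta> (Suc j)"
      unfolding c_def using j(1) by (intro cos_weight_ge \<beta>) auto
    ultimately have "c * 1 \<le> cos_weight n \<beta> (Suc j) * (height f n (fst s) (Suc j) - height f n (snd s) (Suc j))"
      using pos w[of "Suc j"] j(1) by (intro mult_mono) (auto simp: c_def)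
    also have "\<dots> \<le> F s"
      unfolding F using that(1) j(1)
      by (intro member_le_sum mult_nonneg_nonneg w diff) auto
    finally show ?thesis by simp
  qed
  \<comment> \<open>Fewer than \<open>n\<close> terms, each with weight at most 1 and height
    difference at most \<open>n * n\<close>.\<close>
  have F_le: "F s \<le> real n ^ 3" if "I s" for s
  proof -
    have "cos_weight n \<beta> (Suc i) * (height f n (fst s) (Suc i) - height f n (snd s) (Suc i)) \<le> 1 * (real n * real n)"
      if i: "i < n - 1" for i
    proof (intro mult_mono)
      have "height f n (fst s) (Suc i) - height f n (snd s) (Suc i) \<le> (\<Sum>k<Suc i. real (snd s ! k))"
        using height_neg_diff[of n "fst s" "Suc i" "snd s"] sum_nonneg[of "{..<Suc i}" "\<lambda>k. real (fst s ! k)"]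
        by (simp add: f_def[abs_def])
      also have "\<dots> \<le> (\<Sum>k<Suc i. real n)"
      proof (rule sum_mono)
        fix k assume "k \<in> {..<Suc i}"
        moreover have "snd s \<in> permutations_of_set {1..n}" using \<open>I s\<close> by (simp add: I_def)
        ultimately show "real (snd s ! k) \<le> real n"
          using i nth_mem[of k "snd s"] length_finite_permutations_of_set[of "snd s" "{1..n}"]
            permutations_of_setD(1)[of "snd s" "{1..n}"] by auto
      qed
      also have "\<dots> \<le> real n * real n"
        using i by (simp only: sum_constant card_lessThan, intro mult_right_mono) auto
      finally show "height f n (fst s) (Suc i) - height f n (snd s) (Suc i) \<le> real n * real n" .
    qed (use diff[OF \<open>I s\<close>, of "Suc i"] i in \<open>auto simp: cos_weight_def\<close>)
    then have "F s \<le> (\<Sum>i<n - 1. real n * real n)"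
      unfolding F by (intro sum_mono) auto
    also have "\<dots> \<le> real n * (real n * real n)"
      by (simp only: sum_constant card_lessThan, intro mult_right_mono) auto
    finally show ?thesis by (simp add: power3_eq_cube)
  qed
  have drift: "measure_pmf.expectation (move_pmf n) (\<lambda>m. F (step m s)) \<le> (1 - cos_gap n \<beta>) * F s + 0"
    if s: "I s" for s
  proof -
    define d where "d = (cos_weight n \<beta> 0 * (height f n (fst s) 1 - height f n (snd s) 1) +
       cos_weight n \<beta> n * (height f n (fst s) (n - 1) - height f n (snd s) (n - 1))) / (2 * real (n - 1))"
    have "measure_pmf.expectation (move_pmf n) (\<lambda>m. F (step m s)) = (1 - cos_gap n \<beta>) * F s - d"
      using s unfolding d_def F_def step_def I_def fst_conv snd_conv
      by (simp only: Bochner_Integration.integral_diff[OF int int] expectation_cos_sum[OF _ n])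
        (simp add: algebra_simps add_divide_distrib diff_divide_distrib)
    \<comment> \<open>Weights and height differences are nonnegative, so the boundary term can only
      lower the mean and may be dropped.\<close>
    moreover have "0 \<le> d"
      unfolding d_def using n by (intro divide_nonneg_nonneg add_nonneg_nonneg mult_nonneg_nonneg w diff s) auto
    ultimately show ?thesis by linarith
  qed
  have fold: "fold step ms s = (run_moves ms (fst s), run_moves ms (snd s))" for ms s
    by (induction ms arbitrary: s) (auto simp: step_def run_moves_def)
  define s where "s = ([1..<Suc n], rev [1..<Suc n])"
  have I_run: "I (fold step ms s)" if "ms \<in> set_pmf Q" for ms
    using that run_moves_permutation[OF upt_permutation(1) _ n] run_moves_permutation[OF upt_permutation(2) _ n]
      dominates_run_moves[OF dominates_upt(1)[OF upt_permutation(2)] _ _ n]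
    unfolding I_def fold Q_def s_def by (auto simp del: upt_Suc One_nat_def)
  have I_step: "I (step m s)" if "I s" "m \<in> set_pmf (move_pmf n)" for m s
    using that sort_pair_permutation[OF _ _ n] dominates_sort_pair
      length_finite_permutations_of_set[of "fst s" "{1..n}"] length_finite_permutations_of_set[of "snd s" "{1..n}"]
    unfolding I_def step_def by (auto simp: set_move_pmf[OF n])
  have "I s"
    using dominates_upt(1)[OF upt_permutation(2)] upt_permutation by (simp add: I_def s_def del: upt_Suc One_nat_def)
  have "1 - coalescence_prob n t = measure_pmf.expectation Q (\<lambda>ms. 1 - indicator {ms. coalesced n ms} ms)"
    by (simp add: intQ coalescence_prob_def Q_def[symmetric])
  \<comment> \<open>Markov: \<open>F / c\<close> is nonnegative, and at least 1 before
    coalescence.\<close>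
  also have "\<dots> \<le> measure_pmf.expectation Q (\<lambda>ms. F (fold step ms s) / c)"
  proof (rule expectation_mono_finite[OF finQ])
    fix ms assume "ms \<in> set_pmf Q"
    then have I: "I (fold step ms s)" by (rule I_run)
    have eq: "coalesced n ms \<longleftrightarrow> fst (fold step ms s) = snd (fold step ms s)"
      by (simp add: coalesced_def fold s_def del: upt_Suc)
    show "1 - indicator {ms. coalesced n ms} ms \<le> F (fold step ms s) / c"
      using F_nonneg[OF I] F_ge[OF I] pos by (auto simp: eq indicator_def c_def)
  qed
  also have "\<dots> = measure_pmf.expectation Q (\<lambda>ms. F (fold step ms s)) / c"
    by simp
  also have "\<dots> \<le> ((1 - cos_gap n \<beta>) ^ t * F s + 0 * (\<Sum>i<t. (1 - cos_gap n \<beta>) ^ i)) / c"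
    unfolding Q_def using pos cos_gap_le_1[OF n \<beta>]
    by (intro divide_right_mono expectation_fold_le[where I = I] fin I_step drift \<open>I s\<close>) (auto simp: c_def)
  also have "\<dots> \<le> real n ^ 3 * (1 - cos_gap n \<beta>) ^ t / c"
    using F_le[OF \<open>I s\<close>] pos cos_gap_le_1[OF n \<beta>]
    by (auto simp: c_def mult.commute[of "_ ^ t"] intro!: divide_right_mono mult_right_mono)
  finally show ?thesis by (simp add: c_def)
qed

section \<open>First and second moments of the eigenfunction, and the lower bound\<close>

lemma expectation_cos_sum_pi:
  assumes "x \<in> permutations_of_set {1..n}" "2 \<le> n"
  shows "measure_pmf.expectation (move_pmf n) (\<lambda>m. cos_sum f n (pi / n) (sort_pair m x)) =
    (1 - cos_gap n (pi / n)) * cos_sum f n (pi / n) x"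
proof -
  \<comment> \<open>The angles at the two ends are \<open>- pi / 2\<close> and
    \<open>pi / 2\<close>, so the boundary term disappears.\<close>
  have "cos_weight n (pi / n) 0 = 0" "cos_weight n (pi / n) n = 0"
    using assms(2) by (auto simp: cos_weight_def)
  then show ?thesis
    by (simp add: expectation_cos_sum[OF assms])
qed

text \<open>A move changes one height by at most 1, so the sum changes by at most 1. Expanding this
  squared increment bounds the new square by an expression linear in the new sum, whose mean is
  known.\<close>

lemma expectation_cos_sum_pi_square:
  assumes x: "x \<in> permutations_of_set {1..n}" and n: "2 \<le> n"
    and f: "\<And>v. 0 \<le> f v \<and> f v \<le> 1"
  shows "measure_pmf.expectation (move_pmf n) (\<lambda>m. (cos_sum f n (pi / n) (sort_pair m x))\<^sup>2) \<le>
    (1 - cos_gap n (pi / n))\<^sup>2 * (cos_sum f n (pi / n) x)\<^sup>2 + 1"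
proof -
  define S where "S = cos_sum f n (pi / n) x"
  note fin = finite_set_move_pmf[OF n]
  note int = integrable_measure_pmf_finite[OF fin]
  have len: "length x = n" using length_finite_permutations_of_set[OF x] by simp
  have "(cos_sum f n (pi / n) (sort_pair m x))\<^sup>2 \<le> 2 * S * cos_sum f n (pi / n) (sort_pair m x) - S\<^sup>2 + 1"
    if move: "m \<in> set_pmf (move_pmf n)" for m
  proof -
    obtain i b where m: "m = (i, b)" "i < n - 1"
      using move by (auto simp: set_move_pmf[OF n])
    have eq: "(\<Sum>l<i. f (swap_adjacent i x ! l)) = (\<Sum>l<i. f (x ! l))"
      by (intro sum.cong refl) (auto simp: swap_adjacent_def)
    have "height f n (swap_adjacent i x) (Suc i) - height f n x (Suc i) = f (x ! Suc i) - f (x ! i)"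
      using len m(2) eq by (simp add: height_def) (simp add: swap_adjacent_def)
    moreover have "sort_pair (i, b) x = x \<or> sort_pair (i, b) x = swap_adjacent i x"
      using sort_pair_cases[of i x] by (cases b) auto
    ultimately have "\<bar>height f n (sort_pair m x) (Suc i) - height f n x (Suc i)\<bar> \<le> 1"
      using f[of "x ! Suc i"] f[of "x ! i"] m(1) by auto
    then have "\<bar>cos_weight n (pi / n) (Suc i)\<bar> * \<bar>height f n (sort_pair m x) (Suc i) - height f n x (Suc i)\<bar> \<le> 1 * 1"
      by (intro mult_mono) (auto simp: cos_weight_def)
    then have "\<bar>cos_sum f n (pi / n) (sort_pair m x) - S\<bar> \<le> 1"
      using len m by (simp add: cos_sum_sort_pair S_def abs_mult)
    then have "(cos_sum f n (pi / n) (sort_pair m x) - S)\<^sup>2 \<le> 1"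
      by (simp add: abs_square_le_1)
    then show ?thesis
      by (simp add: power2_eq_square algebra_simps)
  qed
  then have "measure_pmf.expectation (move_pmf n) (\<lambda>m. (cos_sum f n (pi / n) (sort_pair m x))\<^sup>2) \<le>
    measure_pmf.expectation (move_pmf n) (\<lambda>m. 2 * S * cos_sum f n (pi / n) (sort_pair m x) - S\<^sup>2 + 1)"
    by (intro expectation_mono_finite fin) auto
  also have "\<dots> = 2 * S * ((1 - cos_gap n (pi / n)) * S) - S\<^sup>2 + 1"
    by (simp add: int expectation_cos_sum_pi[OF x n] flip: S_def)
  \<comment> \<open>Adds the square of \<open>cos_gap n (pi / n) * S\<close> to complete the
    square.\<close>
  also have "\<dots> \<le> (1 - cos_gap n (pi / n))\<^sup>2 * S\<^sup>2 + 1"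
    using zero_le_square[of "cos_gap n (pi / n) * S"] by (simp add: power2_eq_square algebra_simps)
  finally show ?thesis by (simp add: S_def)
qed

text \<open>In equilibrium the second moment is the same before and after a step, so the one-step
  recursion turns into a bound on it.\<close>

lemma second_moment_uniform:
  assumes n: "2 \<le> n" and f: "\<And>v. 0 \<le> f v \<and> f v \<le> 1"
  shows "(1 - (1 - cos_gap n (pi / n))\<^sup>2) * (\<Sum>x\<in>permutations_of_set {1..n}. (cos_sum f n (pi / n) x)\<^sup>2)
    \<le> card (permutations_of_set {1..n})"
proof -
  let ?P = "permutations_of_set {1..n}"
  have "(\<Sum>x\<in>?P. (cos_sum f n (pi / n) x)\<^sup>2) =
     (\<Sum>x\<in>?P. measure_pmf.expectation (move_pmf n) (\<lambda>m. (cos_sum f n (pi / n) (sort_pair m x))\<^sup>2))"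
    by (rule sum_permutations_step[OF n, symmetric])
  also have "\<dots> \<le> (\<Sum>x\<in>?P. (1 - cos_gap n (pi / n))\<^sup>2 * (cos_sum f n (pi / n) x)\<^sup>2 + 1)"
    by (intro sum_mono expectation_cos_sum_pi_square n f)
  also have "\<dots> = (1 - cos_gap n (pi / n))\<^sup>2 * (\<Sum>x\<in>?P. (cos_sum f n (pi / n) x)\<^sup>2) + card ?P"
    by (simp add: sum.distrib sum_distrib_left)
  finally show ?thesis by (simp add: algebra_simps)
qed

text \<open>Chebyshev at level \<open>\<mu> / 2\<close>, with \<open>\<mu>\<close> the mean at time
  \<open>t\<close>: the shuffle misses \<open>B\<close>, and the uniform law hits it, each with
  probability at most \<open>4 / (g * \<mu>\<^sup>2)\<close>. Together they give the 8.\<close>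

lemma variation_ge_cos_sum:
  assumes x: "x \<in> permutations_of_set {1..n}" and n: "2 \<le> n"
    and f: "\<And>v. 0 \<le> f v \<and> f v \<le> 1"
    and gap: "0 < cos_gap n (pi / n)" "cos_gap n (pi / n) < 1"
    and pos: "0 < cos_sum f n (pi / n) x"
  shows "1 - 8 / (cos_gap n (pi / n) * ((1 - cos_gap n (pi / n)) ^ t * cos_sum f n (pi / n) x)\<^sup>2)
    \<le> variation_from_stationarity n t x"
proof -
  let ?P = "permutations_of_set {1..n}"
  define g where "g = cos_gap n (pi / n)"
  define l where "l = 1 - g"
  define F where "F y = cos_sum f n (pi / n) y" for y
  define \<mu> where "\<mu> = l ^ t * F x"
  define Q where "Q = replicate_pmf t (move_pmf n)"
  have l: "0 < l" "l < 1" and g: "0 < g" using gap by (auto simp: g_def l_def)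
  have \<mu>: "0 < \<mu>" using l pos by (simp add: \<mu>_def F_def)
  \<comment> \<open>\<open>g \<le> 1 - l\<^sup>2\<close> will bound both the geometric series of
    accumulated errors and the equilibrium second moment by order \<open>1 / g\<close>.\<close>
  have "g * 1 \<le> g * (1 + l)" using g l by (intro mult_left_mono) auto
  also have "g * (1 + l) = 1 - l\<^sup>2" by (simp add: l_def power2_eq_square algebra_simps)
  finally have gl: "g \<le> 1 - l\<^sup>2" by simp
  have fin: "finite (set_pmf (move_pmf n))" and finQ: "finite (set_pmf Q)"
    unfolding Q_def by (intro finite_set_replicate_pmf finite_set_move_pmf n)+
  note intQ = integrable_measure_pmf_finite[OF finQ]
  define I where "I y \<longleftrightarrow> y \<in> ?P" for y
  have I_step: "I (sort_pair m y)" if "I y" "m \<in> set_pmf (move_pmf n)" for m y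
    using that sort_pair_permutation[OF _ _ n] by (simp add: I_def)
  have "I x" using x by (simp add: I_def)
  \<comment> \<open>The upper drift lemma applied to \<open>- F\<close> yields a lower bound on the
    mean.\<close>
  have "measure_pmf.expectation Q (\<lambda>ms. - F (fold sort_pair ms x)) \<le> l ^ t * - F x + 0 * (\<Sum>i<t. l ^ i)"
    unfolding Q_def using l
    by (intro expectation_fold_le[where I = I] fin I_step \<open>I x\<close>)
      (auto simp: F_def expectation_cos_sum_pi[OF _ n] l_def g_def I_def)
  then have mean: "\<mu> \<le> measure_pmf.expectation Q (\<lambda>ms. F (run_moves ms x))"
    by (simp add: \<mu>_def run_moves_def)
  have "measure_pmf.expectation Q (\<lambda>ms. (F (fold sort_pair ms x))\<^sup>2) \<le> (l\<^sup>2) ^ t * (F x)\<^sup>2 + 1 * (\<Sum>i<t. (l\<^sup>2) ^ i)"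
    unfolding Q_def
    using expectation_cos_sum_pi_square[OF _ n f]
    by (intro expectation_fold_le[where I = I] fin I_step \<open>I x\<close>)
      (auto simp: F_def l_def g_def I_def)
  also have "(l\<^sup>2) ^ t * (F x)\<^sup>2 = \<mu>\<^sup>2"
    by (simp add: \<mu>_def power_mult_distrib power_mult[symmetric] mult.commute)
  also have "(\<Sum>i<t. (l\<^sup>2) ^ i) \<le> 1 / g"
  proof -
    have "(1 - l\<^sup>2) * (\<Sum>i<t. (l\<^sup>2) ^ i) \<le> 1"
      by (simp flip: one_diff_power_eq)
    moreover have "g * (\<Sum>i<t. (l\<^sup>2) ^ i) \<le> (1 - l\<^sup>2) * (\<Sum>i<t. (l\<^sup>2) ^ i)"
      using gl by (intro mult_right_mono sum_nonneg) auto
    ultimately show ?thesis using g by (simp add: field_simps)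
  qed
  finally have square: "measure_pmf.expectation Q (\<lambda>ms. (F (run_moves ms x))\<^sup>2) \<le> \<mu>\<^sup>2 + 1 / g"
    by (simp add: run_moves_def)
  \<comment> \<open>Expanding around \<open>\<mu>\<close> itself needs only that the mean is at
    least \<open>\<mu>\<close>.\<close>
  have "measure_pmf.expectation Q (\<lambda>ms. (F (run_moves ms x) - \<mu>)\<^sup>2)
    = measure_pmf.expectation Q (\<lambda>ms. (F (run_moves ms x))\<^sup>2 - 2 * \<mu> * F (run_moves ms x) + \<mu>\<^sup>2)"
    by (simp add: power2_diff algebra_simps)
  also have "\<dots> = measure_pmf.expectation Q (\<lambda>ms. (F (run_moves ms x))\<^sup>2)
      - 2 * \<mu> * measure_pmf.expectation Q (\<lambda>ms. F (run_moves ms x)) + \<mu>\<^sup>2"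
    by (simp add: intQ)
  also have "\<dots> \<le> 1 / g"
  proof -
    have "\<mu> * \<mu> \<le> \<mu> * measure_pmf.expectation Q (\<lambda>ms. F (run_moves ms x))"
      using \<mu> mean by (intro mult_left_mono) auto
    with square show ?thesis by (simp add: power2_eq_square)
  qed
  finally have var: "measure_pmf.expectation Q (\<lambda>ms. (F (run_moves ms x) - \<mu>)\<^sup>2) \<le> 1 / g" .
  define B where "B = {y. \<mu> / 2 < F y}"
  have markov: "1 - indicator B y \<le> (F y - \<mu>)\<^sup>2 * (4 / \<mu>\<^sup>2)" "indicator B y \<le> (F y)\<^sup>2 * (4 / \<mu>\<^sup>2)" for y
  proof -
    have "1 \<le> z\<^sup>2 * (4 / \<mu>\<^sup>2)" if "\<mu> / 2 \<le> \<bar>z\<bar>" for z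
    proof -
      have "(\<mu> / 2)\<^sup>2 \<le> \<bar>z\<bar>\<^sup>2"
        using that \<mu> by (intro power_mono) auto
      then show ?thesis using \<mu> by (simp add: field_simps power_divide)
    qed
    moreover have "\<mu> / 2 \<le> \<bar>F y\<bar>" if "y \<in> B"
      using that by (simp add: B_def)
    moreover have "\<mu> / 2 \<le> \<bar>F y - \<mu>\<bar>" if "y \<notin> B"
      using that \<mu> by (auto simp: B_def abs_real_def)
    ultimately
    show "1 - indicator B y \<le> (F y - \<mu>)\<^sup>2 * (4 / \<mu>\<^sup>2)" "indicator B y \<le> (F y)\<^sup>2 * (4 / \<mu>\<^sup>2)"
      by (auto simp: indicator_def)
  qed
  have "1 - measure_pmf.prob (shuffle_dist n t x) B = measure_pmf.expectation Q (\<lambda>ms. 1 - indicator B (run_moves ms x))"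
    unfolding prob_shuffle_dist Q_def[symmetric] by (simp add: intQ)
  also have "\<dots> \<le> measure_pmf.expectation Q (\<lambda>ms. (F (run_moves ms x) - \<mu>)\<^sup>2 * (4 / \<mu>\<^sup>2))"
    by (intro expectation_mono_finite finQ markov)
  also have "\<dots> = measure_pmf.expectation Q (\<lambda>ms. (F (run_moves ms x) - \<mu>)\<^sup>2) * (4 / \<mu>\<^sup>2)"
    by simp
  also have "\<dots> \<le> 1 / g * (4 / \<mu>\<^sup>2)"
    using var by (intro mult_right_mono) auto
  finally have lower: "1 - measure_pmf.prob (shuffle_dist n t x) B \<le> 1 / g * (4 / \<mu>\<^sup>2)" .
  have card: "0 < real (card ?P)"
    by (simp add: card_gt_0_iff)
  have "g * (\<Sum>y\<in>?P. (F y)\<^sup>2) \<le> (1 - l\<^sup>2) * (\<Sum>y\<in>?P. (F y)\<^sup>2)"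
    using gl by (intro mult_right_mono sum_nonneg) auto
  also have "\<dots> \<le> card ?P"
    using second_moment_uniform[OF n f] by (simp add: F_def l_def g_def)
  finally have uniform: "(\<Sum>y\<in>?P. (F y)\<^sup>2) \<le> card ?P * (1 / g)"
    using g by (simp add: field_simps)
  have "(\<Sum>y\<in>?P. indicator B y) \<le> (\<Sum>y\<in>?P. (F y)\<^sup>2 * (4 / \<mu>\<^sup>2))"
    by (intro sum_mono markov)
  also have "\<dots> = (\<Sum>y\<in>?P. (F y)\<^sup>2) * (4 / \<mu>\<^sup>2)"
    by (simp only: sum_distrib_right)
  also have "\<dots> \<le> card ?P * (1 / g) * (4 / \<mu>\<^sup>2)"
    using uniform by (intro mult_right_mono) auto
  finally have upper: "measure_pmf.prob (uniform_perm n) B \<le> 1 / g * (4 / \<mu>\<^sup>2)"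
    unfolding prob_uniform_perm using card by (simp add: divide_le_eq mult_ac)
  have "measure_pmf.prob (shuffle_dist n t x) B - measure_pmf.prob (uniform_perm n) B
    \<le> variation_from_stationarity n t x"
    unfolding variation_from_stationarity_def
    by (intro prob_diff_le_tv_dist[OF finite_permutations_of_set variation_support[OF x n]])
  with lower upper have "1 - (1 / g * (4 / \<mu>\<^sup>2) + 1 / g * (4 / \<mu>\<^sup>2)) \<le> variation_from_stationarity n t x"
    by linarith
  also have "1 / g * (4 / \<mu>\<^sup>2) + 1 / g * (4 / \<mu>\<^sup>2) = 8 / (g * \<mu>\<^sup>2)"
    by (simp add: add_divide_distrib[symmetric])
  finally show ?thesis
    by (simp add: \<mu>_def l_def g_def F_def)
qed

text \<open>The marked items are those in the first half of the starting list, so every start is as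
  far from equilibrium as the identity. In the second quarter at least \<open>n / 8\<close>
  positions have weight at least 1/2 and height at least \<open>n / 8\<close>; this yields the
  128.\<close>

lemma cos_sum_first_half_ge:
  assumes x: "x \<in> permutations_of_set {1..n}" and n: "8 \<le> n"
  shows "(real n)\<^sup>2 / 128 \<le> cos_sum (\<lambda>v. of_bool (v \<in> set (take (n div 2) x))) n (pi / n) x"
proof -
  define k where "k = n div 2"
  define f :: "nat \<Rightarrow> real" where "f v = of_bool (v \<in> set (take k x))" for v
  have xs: "length x = n" "distinct x" "set x = {1..n}"
    using length_finite_permutations_of_set[OF x] permutations_of_setD[OF x] by auto
  have k: "k \<le> n" "2 * real k \<le> real n" "real n \<le> 2 * real k + 1"
    by (auto simp: k_def)
  have mem: "x ! i \<in> set (take k x) \<longleftrightarrow> i < k" if "i < n" for i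
    using that xs k(1) by (auto simp: in_set_conv_nth nth_eq_iff_index_eq intro!: exI[of _ i])
  have prefix: "(\<Sum>i<j. f (x ! i)) = min (real j) (real k)" if "j \<le> n" for j
    using that
  proof (induction j)
    case (Suc j)
    then have "f (x ! j) = of_bool (j < k)" by (simp add: f_def mem)
    with Suc show ?case by (auto simp: min_def)
  qed simp
  have total: "(\<Sum>v=1..n. f v) = real k"
    using sum_permutation[OF x, of f] prefix[of n] k(1) by simp
  have height: "height f n x j = min (real j) (real k) - real j * real k / real n" if "j \<le> n" for j
    using prefix[OF that] total by (simp add: height_def)
  have nonneg: "0 \<le> cos_weight n (pi / n) (Suc i) * height f n x (Suc i)" if "i < n - 1" for i
  proof -
    have "real (Suc i) * real k \<le> real (Suc i) * real n" "real (Suc i) * real k \<le> real n * real k"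
      using that k(1) by (intro mult_left_mono mult_right_mono; simp)+
    then have "real (Suc i) * real k \<le> min (real (Suc i)) (real k) * real n"
      by (auto simp: min_def mult.commute)
    then have "real (Suc i) * real k / real n \<le> min (real (Suc i)) (real k)"
      using n by (subst pos_divide_le_eq) auto
    then have "0 \<le> height f n x (Suc i)"
      using that height[of "Suc i"] by simp
    moreover have "0 \<le> cos_weight n (pi / n) (Suc i)"
      using that n by (intro cos_weight_nonneg) auto
    ultimately show ?thesis by simp
  qed
  \<comment> \<open>The angle is at most \<open>pi / 4\<close>, hence below \<open>pi / 3\<close>,
    where the cosine is 1/2. The height is \<open>Suc i * (1 - k / n)\<close>, at least half of
    \<open>Suc i\<close>.\<close>
  have big: "real n / 16 \<le> cos_weight n (pi / n) (Suc i) * height f n x (Suc i)" if "i \<in> {n div 4..<k}" for i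
  proof -
    have i: "real n / 4 \<le> real (Suc i)" "Suc i \<le> k"
      using that by (auto simp: field_simps)
    have "\<bar>real (Suc i) - real n / 2\<bar> \<le> real n / 4"
      using i k(2) by linarith
    then have "\<bar>pi / n * (real (Suc i) - real n / 2)\<bar> \<le> pi / n * (real n / 4)"
      unfolding abs_mult by (intro mult_mono) auto
    also have "pi / n * (real n / 4) \<le> pi / 3"
      using n by simp
    finally have "\<bar>pi / n * (real (Suc i) - real n / 2)\<bar> \<le> pi / 3" .
    then have "cos (pi / 3) \<le> cos \<bar>pi / n * (real (Suc i) - real n / 2)\<bar>"
      by (intro cos_monotone_0_pi_le) auto
    then have weight: "1 / 2 \<le> cos_weight n (pi / n) (Suc i)"
      unfolding cos_weight_def cos_abs_real cos_60 by simp
    have "real (Suc i) * real k \<le> real (Suc i) * (real n / 2)"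
      using k(2) by (intro mult_left_mono) auto
    then have "real (Suc i) * real k / real n \<le> real (Suc i) / 2"
      using n by (simp add: divide_le_eq)
    then have "real n / 8 \<le> height f n x (Suc i)"
      using i k(1) height[of "Suc i"] by (simp add: min_def)
    then have "1 / 2 * (real n / 8) \<le> cos_weight n (pi / n) (Suc i) * height f n x (Suc i)"
      using weight by (intro mult_mono) auto
    then show ?thesis by simp
  qed
  have "real (n div 4) \<le> real n / 4"
    by (simp add: field_simps)
  then have "real n / 8 \<le> real k - real (n div 4)"
    using k n by linarith
  then have "real n / 8 \<le> real (card {n div 4..<k})"
    by (simp add: k_def of_nat_diff)
  then have "real n / 8 * (real n / 16) \<le> real (card {n div 4..<k}) * (real n / 16)"
    by (intro mult_right_mono) auto
  also have "\<dots> \<le> (\<Sum>i\<in>{n div 4..<k}. cos_weight n (pi / n) (Suc i) * height f n x (Suc i))"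
    using sum_mono[of "{n div 4..<k}" "\<lambda>i. real n / 16"] big by simp
  also have "\<dots> \<le> cos_sum f n (pi / n) x"
    unfolding cos_sum_def using nonneg n by (intro sum_mono2) (auto simp: k_def)
  finally show ?thesis
    by (simp add: f_def[abs_def] k_def power2_eq_square)
qed

subsection \<open>Asymptotics\<close>

text \<open>The gap is asymptotically \<open>pi^2 / (2 n^3)\<close>. The factor 2 reflects that the
  contraction enters squared, so \<open>a n^3 log n\<close> steps shrink the square by about
  \<open>n\<close> to the power \<open>- a * pi^2\<close>.\<close>

lemma lower_exponent:
  "(\<lambda>n. - 2 * a * real n ^ 3 * ln (1 - cos_gap n (pi / n))) \<longlonglongrightarrow> a * pi\<^sup>2"
proof -
  have "(\<lambda>n. - 2 * a * real n ^ 3 * ln (1 - (1 - cos (pi / real n)) / (real n - 1))) \<longlonglongrightarrow> a * pi\<^sup>2"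
    by real_asymp (simp add: power2_eq_square)
  moreover have "\<forall>\<^sub>F n in sequentially. - 2 * a * real n ^ 3 * ln (1 - (1 - cos (pi / real n)) / (real n - 1))
     = - 2 * a * real n ^ 3 * ln (1 - cos_gap n (pi / n))"
    using eventually_ge_at_top[of 2] by eventually_elim (simp add: cos_gap_def of_nat_diff)
  ultimately show ?thesis by (rule Lim_transform_eventually)
qed

text \<open>Here the contraction enters unsquared, and the smaller frequency costs a factor
  \<open>b^2\<close> in the gap.\<close>

lemma upper_exponent:
  "(\<lambda>n. - a * real n ^ 3 * ln (1 - cos_gap n (b * pi / n))) \<longlonglongrightarrow> a * b\<^sup>2 * pi\<^sup>2 / 2"
proof -
  have "(\<lambda>n. - a * real n ^ 3 * ln (1 - (1 - cos (b * pi / real n)) / (real n - 1))) \<longlonglongrightarrow> a * b\<^sup>2 * pi\<^sup>2 / 2"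
    by real_asymp (simp add: power2_eq_square)
  moreover have "\<forall>\<^sub>F n in sequentially. - a * real n ^ 3 * ln (1 - (1 - cos (b * pi / real n)) / (real n - 1))
     = - a * real n ^ 3 * ln (1 - cos_gap n (b * pi / n))"
    using eventually_ge_at_top[of 2] by eventually_elim (simp add: cos_gap_def of_nat_diff)
  ultimately show ?thesis by (rule Lim_transform_eventually)
qed


lemma gap_pi_eventually:
  assumes "0 < (b::real)" "b \<le> 1"
  shows "\<forall>\<^sub>F n in sequentially. 0 < cos_gap n (b * pi / n) \<and> cos_gap n (b * pi / n) < 1"
proof -
  have "\<forall>\<^sub>F n in sequentially. 0 < (1 - cos (b * pi / real n)) / (real n - 1)"
    using assms(1) by real_asymp
  moreover have "\<forall>\<^sub>F n in sequentially. (1 - cos (b * pi / real n)) / (real n - 1) < 1"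
    by real_asymp
  ultimately show ?thesis
    using eventually_ge_at_top[of 2] by eventually_elim (simp add: cos_gap_def of_nat_diff)
qed

text \<open>The squared contraction is at least \<open>real n powr (\<eta> - 1)\<close>. With gap of
  order \<open>n^-3\<close> and initial squared sum of order \<open>n^4\<close>, the Chebyshev error
  is of order \<open>n^-\<eta>\<close>.\<close>

lemma eventually_variation_ge:
  assumes \<eta>: "0 < \<eta>" "\<eta> < (1 :: real)"
  shows "\<forall>\<^sub>F n in sequentially. \<forall>t. real t \<le> (1 / pi\<^sup>2 - \<eta>) * real n ^ 3 * ln (real n) \<longrightarrow>
    (\<forall>x \<in> permutations_of_set {1..n}. 1 - \<eta> \<le> variation_from_stationarity n t x)"
proof -
  define a where "a = 1 / pi\<^sup>2 - \<eta>"
  have "1 < pi * pi"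
    using mult_strict_mono[of 1 pi 1 pi] pi_gt3 by simp
  then have "\<eta> * 1 < \<eta> * pi\<^sup>2"
    using \<eta> by (intro mult_strict_left_mono) (auto simp: power2_eq_square)
  then have "a * pi\<^sup>2 < 1 - \<eta>"
    by (simp add: a_def left_diff_distrib)
  then have "\<forall>\<^sub>F n in sequentially. - 2 * a * real n ^ 3 * ln (1 - cos_gap n (pi / n)) < 1 - \<eta>"
    by (rule order_tendstoD(2)[OF lower_exponent])
  \<comment> \<open>\<open>131072\<close> is \<open>8 * 128^2\<close>: 8 from Chebyshev, 128 from
    the initial sum.\<close>
  moreover have "\<forall>\<^sub>F n in sequentially. 131072 / ((1 - cos (pi / real n)) / (real n - 1) * real n powr (\<eta> - 1) * real n ^ 4) < \<eta>"
    using \<eta> by real_asymp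
  moreover have "\<forall>\<^sub>F n in sequentially. 0 < cos_gap n (pi / n) \<and> cos_gap n (pi / n) < 1"
    using gap_pi_eventually[of 1] by simp
  ultimately show ?thesis
    using eventually_ge_at_top[of 8]
  proof eventually_elim
    case (elim n)
    define g where "g = cos_gap n (pi / n)"
    define l where "l = 1 - g"
    have n: "8 \<le> n" "2 \<le> n" using elim by auto
    have g: "0 < g" "g < 1" using elim by (auto simp: g_def)
    have l: "0 < l" "l < 1" using g by (auto simp: l_def)
    have small: "131072 / (g * real n powr (\<eta> - 1) * real n ^ 4) < \<eta>"
      using elim n by (simp add: g_def cos_gap_def of_nat_diff)
    show ?case
    proof (intro allI impI ballI)
      fix t x
      assume t: "real t \<le> (1 / pi\<^sup>2 - \<eta>) * real n ^ 3 * ln (real n)"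
      assume x: "x \<in> permutations_of_set {1..n}"
      define f :: "nat \<Rightarrow> real" where "f v = of_bool (v \<in> set (take (n div 2) x))" for v
      define S where "S = cos_sum f n (pi / n) x"
      have S: "(real n)\<^sup>2 / 128 \<le> S"
        using cos_sum_first_half_ge[OF x n(1)] by (simp add: S_def f_def[abs_def])
      have S_pos: "0 < S"
        using S n by (intro less_le_trans[OF _ S]) auto
      have "real t * (- 2 * ln l) \<le> a * real n ^ 3 * ln (real n) * (- 2 * ln l)"
        using t l by (intro mult_right_mono) (auto simp: a_def)
      also have "\<dots> = (- 2 * a * real n ^ 3 * ln l) * ln (real n)"
        by simp
      also have "\<dots> \<le> (1 - \<eta>) * ln (real n)"
        using elim n by (intro mult_right_mono) (auto simp: l_def g_def)
      finally have "(\<eta> - 1) * ln (real n) \<le> real (2 * t) * ln l"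
        by (simp add: algebra_simps)
      then have "exp ((\<eta> - 1) * ln (real n)) \<le> exp (real (2 * t) * ln l)"
        by simp
      also have "exp (real (2 * t) * ln l) = (l ^ t)\<^sup>2"
        using l unfolding exp_of_nat_mult by (simp add: mult.commute flip: power_mult)
      finally have "real n powr (\<eta> - 1) \<le> (l ^ t)\<^sup>2"
        using n by (simp add: powr_def)
      moreover have "((real n)\<^sup>2 / 128)\<^sup>2 \<le> S\<^sup>2"
        using S by (intro power_mono) auto
      ultimately have "real n powr (\<eta> - 1) * ((real n)\<^sup>2 / 128)\<^sup>2 \<le> (l ^ t)\<^sup>2 * S\<^sup>2"
        by (intro mult_mono) auto
      then have "g * (real n powr (\<eta> - 1) * ((real n)\<^sup>2 / 128)\<^sup>2) \<le> g * (l ^ t * S)\<^sup>2"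
        using g by (intro mult_left_mono) (auto simp: power_mult_distrib)
      then have "8 / (g * (l ^ t * S)\<^sup>2) \<le> 8 / (g * (real n powr (\<eta> - 1) * ((real n)\<^sup>2 / 128)\<^sup>2))"
        using g n l S_pos by (intro divide_left_mono) auto
      also have "\<dots> = 131072 / (g * real n powr (\<eta> - 1) * real n ^ 4)"
        by (simp add: power_divide mult_ac)
      finally have "8 / (g * (l ^ t * S)\<^sup>2) \<le> \<eta>"
        using small by simp
      moreover have "1 - 8 / (g * (l ^ t * S)\<^sup>2) \<le> variation_from_stationarity n t x"
        using variation_ge_cos_sum[OF x n(2), of f t] g S_pos
        by (simp add: g_def l_def S_def f_def)
      ultimately show "1 - \<eta> \<le> variation_from_stationarity n t x"
        by simp
    qed
  qed
qed

text \<open>The initial bound \<open>n^3\<close> must be beaten by a contraction below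
  \<open>real n powr (- (3 + \<eta>))\<close>. This needs
  \<open>a * b^2 * pi^2 / 2 > 3 + \<eta>\<close>; fixing \<open>b < 1\<close> keeps the weights
  above a constant \<open>c\<close> independent of \<open>n\<close>.\<close>

lemma eventually_not_coalesced_le:
  assumes \<eta>: "0 < \<eta>" "\<eta> < (1 :: real)"
  shows "\<forall>\<^sub>F n in sequentially. \<forall>t. (6 / pi\<^sup>2 + \<eta>) * real n ^ 3 * ln (real n) \<le> real t \<longrightarrow>
    1 - coalescence_prob n t \<le> \<eta>"
proof -
  define a where "a = 6 / pi\<^sup>2 + \<eta>"
  define b where "b = 1 - \<eta> / 7"
  have b: "0 < b" "b \<le> 1" "b < 1" using \<eta> by (auto simp: b_def)
  define c where "c = cos (b * pi / 2)"
  have c: "0 < c"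
    unfolding c_def using b by (intro cos_gt_zero) auto
  have "9 \<le> pi\<^sup>2"
    using power_mono[of 3 pi 2] pi_gt3 by simp
  then have "\<eta> * 9 \<le> \<eta> * pi\<^sup>2"
    using \<eta> by (intro mult_left_mono) auto
  moreover have "\<eta> * \<eta> \<le> \<eta> * 1"
    using \<eta> by (intro mult_left_mono) auto
  \<comment> \<open>\<open>pi^2 \<ge> 9\<close> makes the first factor of the target at least
    \<open>3 + 4 * \<eta>\<close>, and \<open>b^2 \<ge> 1 - 2 * \<eta> / 7\<close>; their product is
    at least \<open>3 + 2 * \<eta>\<close>.\<close>
  ultimately have "3 + \<eta> < (3 + 4 * \<eta>) * (1 - 2 * \<eta> / 7)"
    using \<eta> by (simp add: algebra_simps)
  also have "\<dots> \<le> (3 + \<eta> * pi\<^sup>2 / 2) * b\<^sup>2"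
    using \<eta> \<open>\<eta> * 9 \<le> \<eta> * pi\<^sup>2\<close>
    by (intro mult_mono) (auto simp: b_def power2_eq_square algebra_simps)
  also have "\<dots> = a * b\<^sup>2 * pi\<^sup>2 / 2"
    by (simp add: a_def field_simps)
  finally have "\<forall>\<^sub>F n in sequentially. 3 + \<eta> < - a * real n ^ 3 * ln (1 - cos_gap n (b * pi / n))"
    by (rule order_tendstoD(1)[OF upper_exponent])
  moreover have "\<forall>\<^sub>F n in sequentially. real n ^ 3 * real n powr (- (3 + \<eta>)) / c < \<eta>"
    using \<eta> c by real_asymp
  ultimately show ?thesis
    using gap_pi_eventually[OF b(1,2)] eventually_ge_at_top[of 2]
  proof eventually_elim
    case (elim n)
    define l where "l = 1 - cos_gap n (b * pi / n)"
    have l: "0 < l" "l < 1" using elim by (auto simp: l_def)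
    show ?case
    proof (intro allI impI)
      fix t assume t: "(6 / pi\<^sup>2 + \<eta>) * real n ^ 3 * ln (real n) \<le> real t"
      have "(3 + \<eta>) * ln (real n) \<le> (- a * real n ^ 3 * ln l) * ln (real n)"
        using elim by (intro mult_right_mono) (auto simp: l_def)
      also have "\<dots> = a * real n ^ 3 * ln (real n) * (- ln l)"
        by simp
      also have "\<dots> \<le> real t * (- ln l)"
        using t l by (intro mult_right_mono) (auto simp: a_def)
      finally have "exp (real t * ln l) \<le> exp (- (3 + \<eta>) * ln (real n))"
        by (simp add: algebra_simps)
      moreover have "exp (real t * ln l) = l ^ t"
        using l by (simp add: exp_of_nat_mult)
      ultimately have "l ^ t \<le> real n powr (- (3 + \<eta>))"
        using elim by (simp add: powr_def)
      then have "real n ^ 3 * l ^ t / c \<le> real n ^ 3 * real n powr (- (3 + \<eta>)) / c"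
        using c by (intro divide_right_mono mult_left_mono) auto
      also have "\<dots> \<le> \<eta>"
        using elim by simp
      finally have "real n ^ 3 * l ^ t / c \<le> \<eta>" .
      moreover have "1 - coalescence_prob n t \<le> real n ^ 3 * l ^ t / c"
        using not_coalesced_le[of n "b * pi / n" t] elim b c
        by (simp add: l_def c_def)
      ultimately show "1 - coalescence_prob n t \<le> \<eta>"
        by linarith
    qed
  qed
qed

theorem theorem6:
  fixes \<eta> :: real
  assumes "0 < \<eta>" "\<eta> < 1"
  shows "\<exists>N::nat. \<forall>n\<ge>N.
    (\<forall>t::nat. real t \<le> (1 / pi\<^sup>2 - \<eta>) * real n ^ 3 * ln (real n) \<longrightarrow>
        (\<forall>x \<in> permutations_of_set {1..n}. variation_from_stationarity n t x \<ge> 1 - \<eta>) \<and>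
        coalescence_prob n t \<le> \<eta>) \<and>
    (\<forall>t::nat. real t \<ge> (6 / pi\<^sup>2 + \<eta>) * real n ^ 3 * ln (real n) \<longrightarrow>
        (\<forall>x \<in> permutations_of_set {1..n}. variation_from_stationarity n t x \<le> \<eta>) \<and>
        coalescence_prob n t \<ge> 1 - \<eta>)"
proof -
  have "\<forall>\<^sub>F n in sequentially.
    (\<forall>t::nat. real t \<le> (1 / pi\<^sup>2 - \<eta>) * real n ^ 3 * ln (real n) \<longrightarrow>
        (\<forall>x \<in> permutations_of_set {1..n}. variation_from_stationarity n t x \<ge> 1 - \<eta>) \<and>
        coalescence_prob n t \<le> \<eta>) \<and>
    (\<forall>t::nat. real t \<ge> (6 / pi\<^sup>2 + \<eta>) * real n ^ 3 * ln (real n) \<longrightarrow>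
        (\<forall>x \<in> permutations_of_set {1..n}. variation_from_stationarity n t x \<le> \<eta>) \<and>
        coalescence_prob n t \<ge> 1 - \<eta>)"
    using eventually_variation_ge[OF assms] eventually_not_coalesced_le[OF assms] eventually_ge_at_top[of 2]
  proof eventually_elim
    case (elim n)
    \<comment> \<open>The coupling inequality supplies the other half of each part: large variation
      excludes early coalescence, and late coalescence forces small variation.\<close>
    have le: "variation_from_stationarity n t x \<le> 1 - coalescence_prob n t"
      if "x \<in> permutations_of_set {1..n}" for t x
      using variation_le_not_coalesced[OF that elim(3)] .
    have "coalescence_prob n t \<le> \<eta>" if "real t \<le> (1 / pi\<^sup>2 - \<eta>) * real n ^ 3 * ln (real n)" for t
    proof -
      have "1 - \<eta> \<le> variation_from_stationarity n t [1..<Suc n]"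
        using elim(1) that upt_permutation(1) by blast
      with le[OF upt_permutation(1), of t] show ?thesis by linarith
    qed
    moreover have "1 - coalescence_prob n t \<le> \<eta>" if "(6 / pi\<^sup>2 + \<eta>) * real n ^ 3 * ln (real n) \<le> real t" for t
      using elim(2) that by blast
    moreover from this have "variation_from_stationarity n t x \<le> \<eta>"
      if "(6 / pi\<^sup>2 + \<eta>) * real n ^ 3 * ln (real n) \<le> real t" "x \<in> permutations_of_set {1..n}" for t x
      using le[OF that(2), of t] that(1) by fastforce
    ultimately show ?case
      using elim(1) by (force simp del: One_nat_def)
  qed
  then show ?thesis
    by (simp only: eventually_sequentially)
qed

end
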